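(* Let $q\in\{2,3\}$, and put $d_2=6$, $d_3=2$. There exists a finite set $E_q$ of pairs of polynomials in $\mathbb{F}_q[T]$ with the following property: whenever $F,G\in\mathbb{F}_q[T]$ are nonzero monic polynomials with $\varphi(F)=\sigma(G)$, there exist an integer $n\ge 0$ and factorizations $F=\prod_{i=0}^n F_i$, $G=\prod_{i=0}^n G_i$ into monic polynomials with $\gcd(F_i,F_j)=\gcd(G_i,G_j)=1$ for $i\neq j$, such that $(F_0,G_0)\in E_q$ and, for each $1\le i\le n$, $(F_i,G_i)\in V_q(\mathbf{v}_i)$ for some tuple $\mathbf{v}_i=(v_{i,0},v_{i,1},\dots,v_{i,n_i})$ of positive integers with $v_{i,0}\mid d_q$ (i.e. $v_{i,0}\mid 6$ if $q=2$ and $v_{i,0}\mid 2$ if $q=3$).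
   Context: For a nonzero $A\in\mathbb{F}_q[T]$ let $|A|=q^{\deg A}$. A "prime" means a monic irreducible polynomial, and $v_P(F)$ is the exponent of the prime $P$ in $F$. For nonzero $F$, $\varphi(F)=\prod_{P\mid F}|P|^{v_P(F)-1}(|P|-1)$ (product over primes dividing $F$) and $\sigma(G)=\sum_{D\mid G}|D|$ (sum over monic divisors of $G$). For a tuple $\mathbf{v}=(v_0,v_1,\dots,v_m)$ of positive integers ($m\ge 0$), $V_q(\mathbf{v})$ is the set of pairs $(F,G)$ with $G=\prod_{k=1}^m P_k^{v_k}$ and $F=P_{m+1}$, where $P_1,\dots,P_{m+1}$ are primes with $\deg(P_k)=v_0\prod_{j=1}^{k-1}(v_j+1)$ for $k=1,\dots,m+1$. *)

theory Defs
  imports "HOL-Computational_Algebra.Computational_Algebra" "HOL-Library.Cardinality"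
begin

text \<open>
  The field of coefficients is an arbitrary finite field, given as a type \<open>'a\<close> of cardinality \<open>q\<close>.
\<close>

abbreviation monic_poly :: "'a::{field,finite} poly \<Rightarrow> bool" where
  "monic_poly A \<equiv> lead_coeff A = 1"

definition prime_poly :: "'a::{field,finite} poly \<Rightarrow> bool" where
  "prime_poly P \<longleftrightarrow> monic_poly P \<and> irreducible P"

text \<open>Only meaningful for nonzero polynomials (at \<open>0\<close> it takes the value \<open>1\<close>).\<close>
definition abs_poly :: "'a::{field,finite} poly \<Rightarrow> nat" where
  "abs_poly A = CARD('a) ^ degree A"

text \<open>
  The library's \<open>multiplicity\<close> needs a coefficient field with a chosen normalisation and
  gcd; the exponent is therefore defined directly. The set is finite for nonzero \<open>F\<close> and prime \<open>P\<close>.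
\<close>
definition v_poly :: "'a::{field,finite} poly \<Rightarrow> 'a poly \<Rightarrow> nat" where
  "v_poly P F = Max {k. P ^ k dvd F}"

definition phi_poly :: "'a::{field,finite} poly \<Rightarrow> nat" where
  "phi_poly F = (\<Prod>P | prime_poly P \<and> P dvd F. abs_poly P ^ (v_poly P F - 1) * (abs_poly P - 1))"

definition sigma_poly :: "'a::{field,finite} poly \<Rightarrow> nat" where
  "sigma_poly G = (\<Sum>D | monic_poly D \<and> D dvd G. abs_poly D)"

text \<open>
  A tuple \<open>(v\<^sub>0, v\<^sub>1, \<dots>, v\<^sub>m)\<close> is a nonempty list \<open>v\<close>, so that \<open>m + 1 = length v\<close>.
\<close>
definition V_set :: "nat list \<Rightarrow> ('a::{field,finite} poly \<times> 'a poly) set" where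
  "V_set v = {(F, G). \<exists>P :: nat \<Rightarrow> 'a poly.
     (\<forall>k\<in>{1..length v}. prime_poly (P k) \<and> degree (P k) = v ! 0 * (\<Prod>j=1..<k. v ! j + 1)) \<and>
     G = (\<Prod>k=1..<length v. P k ^ (v ! k)) \<and> F = P (length v)}"

definition d_const :: "nat \<Rightarrow> nat" where
  "d_const q = (if q = 2 then 6 else 2)"

end

theory Submission
  imports Defs "HOL-Number_Theory.Number_Theory"
begin

text \<open>
  Since \<open>\<sigma>(G)\<close> is congruent to \<open>1\<close> modulo \<open>q\<close>, the polynomial \<open>F\<close> is squarefree, and \<open>\<phi>(F) = \<sigma>(G)\<close> reads
  \<open>\<Prod>\<^sub>P (q\<^bsup>deg P\<^esup> - 1) \<cdot> \<Prod>\<^sub>Q (q\<^bsup>deg Q\<^esup> - 1) = \<Prod>\<^sub>Q (q\<^bsup>deg Q (e\<^sub>Q + 1)\<^esup> - 1)\<close>, where \<open>P\<close> and \<open>Q\<close> run over the primes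
  dividing \<open>F\<close> and \<open>G\<close> and \<open>e\<^sub>Q\<close> is the exponent of \<open>Q\<close> in \<open>G\<close>. By Zsigmondy's theorem \<open>q\<^sup>n - 1\<close> has a
  primitive prime divisor unless \<open>n\<close> divides \<open>d\<^sub>q\<close>, so an \<open>n\<close> not dividing \<open>d\<^sub>q\<close> is equally often an exponent
  on both sides. Hence every \<open>Q\<close> whose value \<open>deg Q (e\<^sub>Q + 1)\<close> does not divide \<open>d\<^sub>q\<close> can be matched with a
  prime of that degree dividing \<open>F\<close> or \<open>G\<close>; following the matching gives the chains, and the \<open>Q\<close> with
  \<open>deg Q (e\<^sub>Q + 1)\<close> dividing \<open>d\<^sub>q\<close> make up \<open>G\<^sub>0\<close>, while \<open>F\<^sub>0 = 1\<close>.

  Zsigmondy's theorem is proved by taking the Moebius sum of \<open>ln (q\<^sup>m - 1)\<close> over \<open>m = n / t\<close>, \<open>t\<close> a squarefree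
  divisor of \<open>n\<close>, which is the logarithm of the cyclotomic value \<open>\<Phi>\<^sub>n(q)\<close>. It is at least \<open>\<phi>(n) ln q - ln 4\<close>,
  whereas without a primitive prime divisor only the largest prime factor of \<open>n\<close> can divide \<open>\<Phi>\<^sub>n(q)\<close>, and
  only once.
\<close>

section \<open>Primitive prime divisors\<close>

text \<open>When \<open>S\<close> is the set of prime factors of \<open>n\<close>, the products
  \<open>\<Prod>T\<close> run through the squarefree divisors \<open>t\<close> of \<open>n\<close>,
  and \<open>(-1) ^ card T\<close> is the Moebius function of \<open>t\<close>. Indexing by sets of
  primes allows splitting off one prime at a time.\<close>

definition moebius_sum :: "nat set \<Rightarrow> (nat \<Rightarrow> real) \<Rightarrow> real" where
  "moebius_sum S g = (\<Sum>T\<in>Pow S. (-1) ^ card T * g (\<Prod>T))"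

text \<open>The subsets containing \<open>p\<close> are paired with those that do not; adding
  \<open>p\<close> flips the sign. This serves both for induction on \<open>S\<close> and for
  cancelling the terms of \<open>t\<close> and \<open>p * t\<close>.\<close>

lemma moebius_sum_insert:
  assumes "finite S" "p \<notin> S"
  shows "moebius_sum (insert p S) g = moebius_sum S (\<lambda>t. g t - g (p * t))"
proof -
  have inj: "inj_on (insert p) (Pow S)"
    using assms(2) by (auto simp: inj_on_def)
  have "moebius_sum (insert p S) g = (\<Sum>T\<in>Pow S. (-1) ^ card T * g (\<Prod>T))
      + (\<Sum>T\<in>insert p ` Pow S. (-1) ^ card T * g (\<Prod>T))"
    unfolding moebius_sum_def Pow_insert using assms by (intro sum.union_disjoint) auto
  also have "(\<Sum>T\<in>insert p ` Pow S. (-1) ^ card T * g (\<Prod>T))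
      = (\<Sum>T\<in>Pow S. (-1) ^ card (insert p T) * g (\<Prod>(insert p T)))"
    by (simp add: sum.reindex[OF inj])
  also have "\<dots> = (\<Sum>T\<in>Pow S. - ((-1) ^ card T * g (p * \<Prod>T)))"
  proof (rule sum.cong)
    fix T assume "T \<in> Pow S"
    then have "finite T" "p \<notin> T"
      using assms finite_subset by auto
    then show "(-1) ^ card (insert p T) * g (\<Prod>(insert p T)) = - ((-1) ^ card T * g (p * \<Prod>T))"
      by simp
  qed simp
  finally show ?thesis
    unfolding moebius_sum_def by (simp add: right_diff_distrib sum_subtractf sum_negf)
qed

lemma moebius_sum_cong:
  assumes "\<And>T. T \<subseteq> S \<Longrightarrow> g (\<Prod>T) = h (\<Prod>T)"
  shows "moebius_sum S g = moebius_sum S h"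
  unfolding moebius_sum_def by (rule sum.cong) (auto simp: assms)

text \<open>Inserting a prime \<open>p\<close> only rescales \<open>c\<close> by
  \<open>1 - 1 / p\<close>, so the induction keeps \<open>c\<close> arbitrary.\<close>

lemma moebius_sum_inverse:
  assumes "finite S"
  shows "moebius_sum S (\<lambda>t. c / real t) = c * (\<Prod>p\<in>S. 1 - 1 / real p)"
  using assms
proof (induction S arbitrary: c rule: finite_induct)
  case empty
  then show ?case by (simp add: moebius_sum_def)
next
  case (insert p S)
  have "moebius_sum (insert p S) (\<lambda>t. c / real t) = moebius_sum S (\<lambda>t. (c * (1 - 1 / real p)) / real t)"
    by (subst moebius_sum_insert[OF insert(1,2)], rule moebius_sum_cong) (simp add: divide_simps algebra_simps)
  then show ?case
    using insert by simp
qed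

lemma prod_subset_prime_factors_dvd:
  fixes n :: nat
  assumes "T \<subseteq> prime_factors n" "n > 0"
  shows "\<Prod>T dvd n"
proof -
  have "\<Prod>T dvd (\<Prod>p\<in>T. p ^ multiplicity p n)"
    using assms by (intro prod_dvd_prod) (auto simp: prime_factors_multiplicity dvd_power)
  also have "\<dots> dvd (\<Prod>p\<in>prime_factors n. p ^ multiplicity p n)"
    using assms by (intro prod_dvd_prod_subset) auto
  also have "\<dots> = n"
    using assms prime_factorization_nat[of n] by simp
  finally show ?thesis .
qed

section \<open>The lower bound for the logarithm of the cyclotomic value\<close>

text \<open>Euler's product for the totient. It supplies the main term of the bound, the coefficient
  of \<open>ln q\<close>.\<close>

lemma moebius_sum_totient:
  fixes n :: nat
  assumes "n > 0"
  shows "moebius_sum (prime_factors n) (\<lambda>t. real (n div t)) = real (totient n)"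
proof -
  have "moebius_sum (prime_factors n) (\<lambda>t. real (n div t)) = moebius_sum (prime_factors n) (\<lambda>t. real n / real t)"
    by (rule moebius_sum_cong) (use prod_subset_prime_factors_dvd[OF _ assms] in \<open>auto simp: real_of_nat_div\<close>)
  also have "\<dots> = real (totient n)"
    by (simp add: moebius_sum_inverse totient_formula2)
  finally show ?thesis .
qed

text \<open>Only the bound \<open>1 / 4\<close> is wanted; the extra summand
  \<open>1 / 2 ^ (n + 1)\<close> makes the induction go through.\<close>

lemma prod_one_minus_inverse_power2_ge:
  assumes "n \<ge> 1"
  shows "(\<Prod>k=1..n. 1 - 1 / 2 ^ k) \<ge> (1 / 4 + 1 / 2 ^ (n + 1) :: real)"
  using assms
proof (induction n rule: dec_induct)
  case base
  then show ?case by simp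
next
  case (step n)
  define x :: real where "x = 1 / 2 ^ (n + 1)"
  have x: "0 < x" "x \<le> 1 / 4"
  proof -
    have "(2::real) ^ 2 \<le> 2 ^ (n + 1)"
      using step by (intro power_increasing) auto
    then show "x \<le> 1 / 4" by (simp add: x_def divide_simps)
  qed (simp add: x_def)
  have "1 / 4 + x / 2 \<le> (1 / 4 + x) * (1 - x)"
  proof -
    have "x * x \<le> x * (1 / 4)" using x by (intro mult_left_mono) auto
    moreover have "(1 / 4 + x) * (1 - x) = 1 / 4 + x - x * (1 / 4) - x * x"
      by (simp add: field_simps)
    ultimately show ?thesis using x by linarith
  qed
  also have "\<dots> \<le> (\<Prod>k=1..n. 1 - 1 / 2 ^ k) * (1 - x)"
    using step x by (intro mult_right_mono) (auto simp: x_def)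
  also have "\<dots> = (\<Prod>k=1..Suc n. 1 - 1 / 2 ^ k)"
    by (simp add: x_def)
  finally show ?case by (simp add: x_def)
qed

text \<open>\<open>T\<close> is recovered from \<open>\<Prod>T\<close> as its set of prime factors.
  Hence no value \<open>n div t\<close> occurs twice in a Moebius sum.\<close>

lemma inj_on_div_prod_prime_factors:
  fixes n :: nat
  assumes "n > 0"
  shows "inj_on (\<lambda>T. n div \<Prod>T) (Pow (prime_factors n))"
proof (rule inj_onI)
  fix T U assume TU: "T \<in> Pow (prime_factors n)" "U \<in> Pow (prime_factors n)" and eq: "n div \<Prod>T = n div \<Prod>U"
  have dvd: "\<Prod>T dvd n" "\<Prod>U dvd n"
    using TU prod_subset_prime_factors_dvd assms by auto
  have pf: "prime_factors (\<Prod>X) = X" if X: "X \<in> Pow (prime_factors n)" for X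
  proof -
    have fin: "finite X" using X finite_subset by blast
    have "prime_factors (\<Prod>X) = (\<Union>x\<in>X. prime_factors x)"
      using X by (subst prime_factors_prod[OF fin]) (auto dest: in_prime_factors_imp_prime)
    also have "\<dots> = X"
    proof -
      have "prime_factors x = {x}" if "x \<in> X" for x
        using that X by (intro prime_prime_factors) auto
      then show ?thesis by simp
    qed
    finally show ?thesis .
  qed
  have "\<Prod>T = \<Prod>U"
    using dvd eq assms by (metis dvd_div_eq_iff div_by_0 dvd_div_mult_self mult_is_0 nat_mult_eq_cancel1 neq0_conv)
  then show "T = U" using pf TU by metis
qed

text \<open>Each \<open>ln (q ^ m - 1)\<close> equals \<open>m * ln q + h m\<close> with
  \<open>h m = ln (1 - 1 / q ^ m) \<le> 0\<close>. The first parts add up to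
  \<open>totient n * ln q\<close>. The second parts, with whatever signs, are bounded below by the
  sum of all \<open>h k\<close> with \<open>1 \<le> k \<le> n\<close>, which is at least
  \<open>- ln 4\<close>.\<close>

lemma moebius_sum_ln_ge:
  fixes q n :: nat
  assumes q: "q \<ge> 2" and n: "n > 0"
  shows "moebius_sum (prime_factors n) (\<lambda>t. ln (real (q ^ (n div t) - 1))) \<ge> real (totient n) * ln (real q) - ln 4"
proof -
  define h where "h = (\<lambda>m. ln (1 - 1 / real q ^ m))"
  let ?S = "prime_factors n"
  have pos: "n div \<Prod>T \<ge> 1 \<and> n div \<Prod>T \<le> n" if "T \<subseteq> ?S" for T
    using prod_subset_prime_factors_dvd[OF that n] n by (auto elim!: dvdE)
  have half: "1 / real q ^ m \<le> 1 / 2 ^ m \<and> 1 / real q ^ m \<le> 1 / 2" if "m \<ge> 1" for m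
  proof -
    have "(2::real) ^ 1 \<le> 2 ^ m" using that by (intro power_increasing) auto
    moreover have "(2::real) ^ m \<le> real q ^ m" using q by (intro power_mono) auto
    ultimately have "1 / real q ^ m \<le> 1 / 2 ^ m" "1 / real q ^ m \<le> 1 / 2"
      using q by (intro divide_left_mono mult_pos_pos; simp)+
    then show ?thesis by simp
  qed
  have hneg: "h m \<le> 0" if "m \<ge> 1" for m
    unfolding h_def using half[OF that] q by simp
  have ln_eq: "ln (real (q ^ m - 1)) = ln q * real m + h m" if "m \<ge> 1" for m
  proof -
    have "real (q ^ m - 1) = real q ^ m * (1 - 1 / real q ^ m)"
      using q by (simp add: algebra_simps of_nat_diff)
    moreover have "1 - 1 / real q ^ m > 0" using half[OF that] by simp
    ultimately show ?thesis
      using q unfolding h_def by (simp add: ln_mult ln_realpow)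
  qed
  have "moebius_sum ?S (\<lambda>t. ln (real (q ^ (n div t) - 1))) = moebius_sum ?S (\<lambda>t. ln q * real (n div t) + h (n div t))"
    by (rule moebius_sum_cong) (use pos ln_eq in auto)
  also have "\<dots> = ln q * moebius_sum ?S (\<lambda>t. real (n div t)) + moebius_sum ?S (\<lambda>t. h (n div t))"
    unfolding moebius_sum_def by (simp add: sum.distrib sum_distrib_left algebra_simps)
  also have "moebius_sum ?S (\<lambda>t. real (n div t)) = totient n"
    by (rule moebius_sum_totient[OF n])
  finally have eq: "moebius_sum ?S (\<lambda>t. ln (real (q ^ (n div t) - 1)))
      = ln q * totient n + moebius_sum ?S (\<lambda>t. h (n div t))" .
  have "- ln 4 \<le> (\<Sum>k=1..n. h k)"
  proof -
    have "(1 / 4 :: real) \<le> (\<Prod>k=1..n. 1 - 1 / 2 ^ k)"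
      using prod_one_minus_inverse_power2_ge[of n] n zero_less_power[of "2::real" "n+1"]
      by (smt (verit) One_nat_def Suc_leI zero_less_divide_1_iff)
    also have "\<dots> \<le> (\<Prod>k=1..n. 1 - 1 / real q ^ k)"
    proof (rule prod_mono)
      fix k assume "k \<in> {1..n}"
      then show "0 \<le> 1 - 1 / (2::real) ^ k \<and> 1 - 1 / 2 ^ k \<le> 1 - 1 / real q ^ k"
        using half[of k] by simp
    qed
    finally have le: "(1 / 4 :: real) \<le> (\<Prod>k=1..n. 1 - 1 / real q ^ k)" .
    have "ln (1 / 4 :: real) \<le> ln (\<Prod>k=1..n. 1 - 1 / real q ^ k)"
      using le by (subst ln_le_cancel_iff) linarith+
    also have "\<dots> = (\<Sum>k=1..n. h k)"
      unfolding h_def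
    proof (rule ln_prod)
      fix k assume "k \<in> {1..n}"
      then have "1 / real q ^ k \<le> 1 / 2" using half[of k] by simp
      then show "1 - 1 / real q ^ k \<noteq> 0" by linarith
    qed simp
    finally show ?thesis by (simp add: ln_div)
  qed
  \<comment> \<open>As \<open>h\<close> is nonpositive, passing to a subset of the indices can only
    increase the sum.\<close>
  also have "\<dots> \<le> (\<Sum>k\<in>(\<lambda>T. n div \<Prod>T) ` Pow ?S. h k)"
  proof -
    have "(\<Sum>k\<in>(\<lambda>T. n div \<Prod>T) ` Pow ?S. - h k) \<le> (\<Sum>k=1..n. - h k)"
      using pos hneg by (intro sum_mono2) auto
    then show ?thesis by (simp add: sum_negf)
  qed
  also have "\<dots> = (\<Sum>T\<in>Pow ?S. h (n div \<Prod>T))"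
    by (simp add: sum.reindex[OF inj_on_div_prod_prime_factors[OF n]])
  also have "\<dots> \<le> moebius_sum ?S (\<lambda>t. h (n div t))"
    unfolding moebius_sum_def
  proof (rule sum_mono)
    fix T assume "T \<in> Pow ?S"
    then have "h (n div \<Prod>T) \<le> 0" using pos hneg by auto
    then show "h (n div \<Prod>T) \<le> (-1) ^ card T * h (n div \<Prod>T)"
      by (cases "even (card T)") auto
  qed
  finally show ?thesis using eq by (simp add: mult.commute)
qed

section \<open>The exponent of a prime in \<open>x ^ k - 1\<close>\<close>

lemma power_minus_one_factor_nat:
  fixes x :: nat
  assumes "x \<ge> 1"
  shows "x ^ k - 1 = (x - 1) * (\<Sum>i<k. x ^ i)"
proof -
  have "int (x ^ k - 1) = int ((x - 1) * (\<Sum>i<k. x ^ i))"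
    using assms power_diff_1_eq[of "int x" k] by (simp add: of_nat_diff)
  then show ?thesis using of_nat_eq_iff by blast
qed

lemma multiplicity_power_minus_one_mult:
  fixes l x k :: nat
  assumes "prime l" "x \<ge> 2" "k > 0"
  shows "multiplicity l (x ^ k - 1) = multiplicity l (x - 1) + multiplicity l (\<Sum>i<k. x ^ i)"
proof -
  have "(\<Sum>i<k. x ^ i) \<ge> (\<Sum>i<k. 1)" using assms by (intro sum_mono) auto
  then have "(\<Sum>i<k. x ^ i) \<noteq> 0" using assms by (simp del: sum_eq_0_iff)
  then show ?thesis
    using assms by (subst power_minus_one_factor_nat) (simp_all add: prime_elem_multiplicity_mult_distrib)
qed

text \<open>Modulo \<open>l\<close> the geometric sum is congruent to \<open>k\<close>, so this
  cofactor contributes no factor \<open>l\<close>.\<close>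

lemma multiplicity_power_minus_one_coprime:
  fixes l x k :: nat
  assumes "prime l" "x \<ge> 2" "[x = 1] (mod l)" "\<not> l dvd k"
  shows "multiplicity l (x ^ k - 1) = multiplicity l (x - 1)"
proof -
  have "[(\<Sum>i<k. x ^ i) = (\<Sum>i<k. 1 ^ i)] (mod l)"
    using assms by (intro cong_sum cong_pow) auto
  then have "\<not> l dvd (\<Sum>i<k. x ^ i)"
    using assms(4) cong_dvd_iff by force
  moreover have "k > 0" using assms(4) by (auto intro: Nat.gr0I)
  ultimately show ?thesis
    using multiplicity_power_minus_one_mult[OF assms(1,2), of k] by (simp add: not_dvd_imp_multiplicity_0)
qed

text \<open>One direction of lifting the exponent: the cofactor \<open>\<Sum>i<l. x ^ i\<close> is
  not divisible by \<open>l ^ 2\<close>. For \<open>l = 2\<close> the cofactor is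
  \<open>x + 1\<close>, and \<open>x = 3\<close> shows why a congruence modulo 4 is
  demanded.\<close>

lemma multiplicity_power_minus_one_self:
  fixes l x :: nat
  assumes l: "prime l" and x: "x \<ge> 2" "[x = 1] (mod l)" and two: "l = 2 \<Longrightarrow> [x = 1] (mod 4)"
  shows "multiplicity l (x ^ l - 1) \<le> multiplicity l (x - 1) + 1"
proof -
  have l0: "l > 0" using l by (simp add: prime_gt_0_nat)
  obtain y where y: "x = 1 + l * y"
    using x by (metis cong_to_1_nat dvd_def le_add_diff_inverse2 add.commute one_le_numeral le_trans)
  have pow: "[(1 + l * y) ^ i = 1 + i * (l * y)] (mod l ^ 2)" for i
  proof (induction i)
    case (Suc i)
    have "[(1 + l * y) * (1 + l * y) ^ i = (1 + l * y) * (1 + i * (l * y))] (mod l ^ 2)"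
      using Suc by (rule cong_scalar_left)
    also have "(1 + l * y) * (1 + i * (l * y)) = 1 + Suc i * (l * y) + l ^ 2 * (i * y * y)"
      by (simp add: algebra_simps power2_eq_square)
    also have "[\<dots> = 1 + Suc i * (l * y)] (mod l ^ 2)"
      by (simp add: cong_def)
    finally show ?case by simp
  qed simp
  have nd: "\<not> l ^ 2 dvd (\<Sum>i<l. x ^ i)"
  proof (cases "l = 2")
    case True
    have "[x + 1 = 1 + 1] (mod 4)" using two[OF True] by (rule cong_add) simp
    then have "\<not> 4 dvd x + 1" using cong_dvd_iff[of "x + 1" "1 + 1" 4] by (simp add: numeral_2_eq_2[symmetric])
    moreover have "(\<Sum>i<2. x ^ i) = x + 1" by (simp add: numeral_2_eq_2)
    ultimately show ?thesis using True by simp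
  next
    case False
    then have odd: "odd l" using l primes_dvd_imp_eq two_is_prime_nat by blast
    \<comment> \<open>For odd \<open>l\<close> the number \<open>l\<close> divides
      \<open>\<Sum>i<l. i\<close>, so the linear terms vanish modulo \<open>l ^ 2\<close> and the
      sum is congruent to \<open>l\<close>.\<close>
    have "[(\<Sum>i<l. x ^ i) = (\<Sum>i<l. 1 + i * (l * y))] (mod l ^ 2)"
      unfolding y by (intro cong_sum pow)
    also have "(\<Sum>i<l. 1 + i * (l * y)) = l + (\<Sum>i<l. i) * (l * y)"
      unfolding sum.distrib sum_distrib_right[symmetric] by simp
    also have "(\<Sum>i<l. i) = l * ((l - 1) div 2)"
    proof -
      have "(\<Sum>i<l. i) = l * (l - 1) div 2"
      proof -
        obtain j where "l = Suc j" using l0 gr0_implies_Suc by blast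
        then show ?thesis
          using gauss_sum_nat[of j] by (simp only: lessThan_Suc_atMost atLeast0AtMost diff_Suc_1 mult.commute)
      qed
      moreover have "even (l - 1)" using odd by simp
      ultimately show ?thesis by (simp only: div_mult_swap)
    qed
    also have "l + l * ((l - 1) div 2) * (l * y) = l + l ^ 2 * ((l - 1) div 2 * y)"
      by (simp add: algebra_simps power2_eq_square)
    also have "[\<dots> = l] (mod l ^ 2)" by (simp add: cong_def)
    finally have "l ^ 2 dvd (\<Sum>i<l. x ^ i) \<longleftrightarrow> l ^ 2 dvd l" by (rule cong_dvd_iff)
    moreover have "\<not> l ^ 2 dvd l"
      using l by (auto simp: power2_eq_square prime_nat_iff dest!: dvd_imp_le)
    ultimately show ?thesis by simp
  qed
  have "(\<Sum>i<l. x ^ i) \<noteq> 0" using nd by (metis dvd_0_right)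
  then have "multiplicity l (\<Sum>i<l. x ^ i) < 2"
    using l nd by (intro multiplicity_lessI) auto
  then show ?thesis
    using multiplicity_power_minus_one_mult[OF l x(1) l0] by simp
qed

text \<open>The set \<open>L\<close> may exceed the prime factors of \<open>m\<close>, so that one
  \<open>L\<close> serves all the numbers \<open>q ^ (n div t) - 1\<close> at once and the two
  summations can be interchanged.\<close>

lemma ln_eq_sum_multiplicity:
  fixes m :: nat
  assumes "m > 0" "finite L" "prime_factors m \<subseteq> L" "\<And>l. l \<in> L \<Longrightarrow> prime l"
  shows "ln (real m) = (\<Sum>l\<in>L. ln (real l) * real (multiplicity l m))"
proof -
  have "ln (real m) = ln (\<Prod>l\<in>prime_factors m. real l ^ multiplicity l m)"
    using assms(1) by (subst (1) prime_factorization_nat) (simp_all add: of_nat_prod)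
  also have "\<dots> = (\<Sum>l\<in>prime_factors m. ln (real l ^ multiplicity l m))"
    by (rule ln_prod) (auto intro: prime_factors_gt_0_nat)
  also have "\<dots> = (\<Sum>l\<in>prime_factors m. ln (real l) * real (multiplicity l m))"
    by (rule sum.cong) (auto simp: ln_realpow prime_gt_0_nat in_prime_factors_imp_prime)
  also have "\<dots> = (\<Sum>l\<in>L. ln (real l) * real (multiplicity l m))"
  proof (rule sum.mono_neutral_left[OF assms(2,3)], rule ballI)
    fix l assume l: "l \<in> L - prime_factors m"
    show "ln (real l) * real (multiplicity l m) = 0"
      using l assms(4)[of l] by (auto simp: prime_factors_multiplicity)
  qed
  finally show ?thesis .
qed

text \<open>If \<open>l\<close> and \<open>q\<close> are not coprime, then
  \<open>ord l q = 0\<close> and both sides hold for \<open>m = 0\<close> only.\<close>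

lemma dvd_power_minus_one_iff_ord_dvd:
  fixes l q m :: nat
  assumes "q \<ge> 1"
  shows "l dvd q ^ m - 1 \<longleftrightarrow> ord l q dvd m"
proof -
  have "[q ^ m = 1] (mod l) \<longleftrightarrow> l dvd q ^ m - 1"
    using assms cong_altdef_nat[of 1 "q ^ m" l] by simp
  then show ?thesis using ord_divides by metis
qed

text \<open>
  The order \<open>d\<close> of \<open>q\<close> modulo \<open>l\<close> is a proper divisor of \<open>n\<close> (otherwise the sum vanishes). If some prime
  \<open>p \<noteq> l\<close> divides \<open>n / d\<close>, the terms for \<open>t\<close> and \<open>p t\<close> cancel. Otherwise \<open>n / d\<close> is a power of \<open>l\<close>, only
  \<open>t = 1\<close> and \<open>t = l\<close> contribute, and \<open>l\<close> is the largest prime factor of \<open>n\<close> because \<open>d\<close> divides \<open>l - 1\<close>.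
\<close>

lemma moebius_sum_multiplicity_le:
  fixes l q n :: nat
  assumes l: "prime l" and q: "q \<ge> 2" and n: "n > 2" and ord: "ord l q \<noteq> n"
  shows "moebius_sum (prime_factors n) (\<lambda>t. real (multiplicity l (q ^ (n div t) - 1)))
      \<le> (if l = Max (prime_factors n) then 1 else 0)"
proof -
  define d where "d = ord l q"
  define f where "f = (\<lambda>m. multiplicity l (q ^ m - 1))"
  let ?S = "prime_factors n"
  let ?g = "\<lambda>t. real (f (n div t))"
  have n0: "n > 0" using n by simp
  have f0: "f m = 0" if "\<not> d dvd m" for m
    using that dvd_power_minus_one_iff_ord_dvd[of q l m] q by (simp add: f_def d_def not_dvd_imp_multiplicity_0)
  have q_pow: "q ^ m \<ge> 2" if "m > 0" for m
    using that q self_le_power[of q m] by linarith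
  have dvdn: "\<Prod>T dvd n" if "T \<subseteq> ?S" for T
    using prod_subset_prime_factors_dvd[OF that n0] .
  have "moebius_sum ?S ?g \<le> (if l = Max ?S then 1 else 0)"
  proof (cases "d dvd n")
    case False
    have "moebius_sum ?S ?g = moebius_sum ?S (\<lambda>_. 0)"
    proof (rule moebius_sum_cong)
      fix T assume "T \<subseteq> ?S"
      then have "n div \<Prod>T dvd n" using dvdn by (metis dvd_div_mult_self dvd_triv_left)
      then show "?g (\<Prod>T) = 0" using False f0 dvd_trans by auto
    qed
    then show ?thesis by (simp add: moebius_sum_def)
  next
    case True
    then obtain k where k: "n = d * k" by blast
    have d0: "d > 0" and k0: "k > 0" using k n0 by auto
    have k1: "k \<noteq> 1" using ord k by (auto simp: d_def)
    show ?thesis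
    proof (cases "\<exists>p. prime p \<and> p \<noteq> l \<and> p dvd k")
      case True
      then obtain p where p: "prime p" "p \<noteq> l" "p dvd k" by blast
      define S' where "S' = ?S - {p}"
      have pS: "p \<in> ?S" using p k n0 by (auto simp: prime_factors_dvd)
      have S: "?S = insert p S'" "p \<notin> S'" "finite S'" using pS by (auto simp: S'_def)
      have "moebius_sum ?S ?g = moebius_sum S' (\<lambda>t. ?g t - ?g (p * t))"
        unfolding S(1) using S by (intro moebius_sum_insert) auto
      also have "\<dots> = moebius_sum S' (\<lambda>_. 0)"
      proof (rule moebius_sum_cong)
        fix T assume T: "T \<subseteq> S'"
        let ?t = "\<Prod>T"
        have fT: "finite T" using T S finite_subset by blast
        have "p * ?t dvd n"
        proof -
          have "p \<notin> T" using T S by blast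
          then show ?thesis using dvdn[of "insert p T"] T S fT by auto
        qed
        then obtain m where m: "n = p * ?t * m" by blast
        have t0: "?t > 0" "m > 0" "p > 0" using m n0 by (auto intro: Nat.gr0I)
        have nt: "n div ?t = m * p" "n div (p * ?t) = m"
          using m t0 by (simp_all add: mult.assoc mult.left_commute[of p] mult.commute[of p])
        \<comment> \<open>If \<open>d\<close> divides \<open>n div ?t\<close>, then
          \<open>k = ?t * r\<close>; since \<open>p\<close> divides \<open>k\<close> and is coprime
          to \<open>?t\<close>, it divides \<open>r\<close>, so \<open>d\<close> already divides
          \<open>n div (p * ?t) = m\<close>. Raising \<open>q ^ m\<close> to the power
          \<open>p \<noteq> l\<close> does not change the exponent of \<open>l\<close>.\<close>
        show "?g ?t - ?g (p * ?t) = 0"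
        proof (cases "d dvd m * p")
          case False
          then have "\<not> d dvd m" by auto
          then show ?thesis using False f0 nt by simp
        next
          case True
          then obtain r where r: "m * p = d * r" by blast
          have "d * k = ?t * (m * p)" using k m by (simp add: ac_simps)
          then have "d * k = d * (?t * r)" unfolding r by (simp add: ac_simps)
          then have "k = ?t * r" using d0 by simp
          moreover have "coprime p ?t"
          proof (rule prod_coprime_right)
            fix s assume "s \<in> T"
            then have "prime s" "s \<noteq> p" using T by (auto simp: S'_def)
            then show "coprime p s" using p primes_coprime by metis
          qed
          ultimately have "p dvd r" using p by (simp add: coprime_dvd_mult_right_iff)
          then obtain s where "r = p * s" by blast
          then have dm: "d dvd m" using r t0 by auto
          have "f (m * p) = f m"
            unfolding f_def power_mult
          proof (rule multiplicity_power_minus_one_coprime[OF l])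
            show "q ^ m \<ge> 2" using q_pow t0 by simp
            show "[q ^ m = 1] (mod l)" using dm ord_divides unfolding d_def by metis
            show "\<not> l dvd p" using p l primes_dvd_imp_eq by blast
          qed
          then show ?thesis using nt by simp
        qed
      qed
      finally show ?thesis by (simp add: moebius_sum_def)
    next
      case False
      then have only: "p = l" if "prime p" "p dvd k" for p using that by blast
      obtain p where "prime p" "p dvd k" using k1 prime_factor_nat by blast
      then have lk: "l dvd k" using only by blast
      define S' where "S' = ?S - {l}"
      have lS: "l \<in> ?S" using l lk k n0 by (auto simp: prime_factors_dvd)
      have S: "?S = insert l S'" "l \<notin> S'" "finite S'" using lS by (auto simp: S'_def)
      have l0: "l > 0" using l prime_gt_0_nat by blast
      obtain j where j: "k = l * j" using lk by blast
      define m where "m = d * j"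
      have nm: "n = m * l" "m > 0" using k j n0 by (auto simp: m_def)
      have dm: "d dvd m" by (simp add: m_def)
      \<comment> \<open>If \<open>d\<close> divided \<open>n div t\<close>, then \<open>t\<close>,
        and with it \<open>p\<close>, would divide \<open>k\<close>, whose only prime factor is
        \<open>l\<close>.\<close>
      have nz: "\<not> d dvd n div t" if "t dvd n" "p dvd t" "p \<in> S'" for t p
      proof
        assume "d dvd n div t"
        then obtain r where "n div t = d * r" by blast
        then have "n = t * (d * r)" using that by (metis dvd_mult_div_cancel)
        then have "k = t * r" using k d0 by (auto simp: mult.left_commute)
        then show False using that only[of p] by (auto simp: S'_def)
      qed
      have "moebius_sum ?S ?g = moebius_sum S' (\<lambda>t. ?g t - ?g (l * t))"
        unfolding S(1) using S by (intro moebius_sum_insert) auto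
      also have "\<dots> = (\<Sum>T\<in>{{}}. (-1) ^ card T * (?g (\<Prod>T) - ?g (l * \<Prod>T)))"
        unfolding moebius_sum_def
      proof (rule sum.mono_neutral_right)
        show "\<forall>T\<in>Pow S' - {{}}. (-1) ^ card T * (?g (\<Prod>T) - ?g (l * \<Prod>T)) = 0"
        proof
          fix T assume T: "T \<in> Pow S' - {{}}"
          then obtain p where p: "p \<in> T" by blast
          have fT: "finite T" using T S finite_subset by blast
          have *: "p dvd \<Prod>T" "p \<in> S'" using p T fT by (auto intro: dvd_prodI)
          have 1: "\<Prod>T dvd n" using dvdn T S by blast
          have "l \<notin> T" using T S by blast
          then have "l * \<Prod>T dvd n" using dvdn[of "insert l T"] T S fT by auto
          then show "(-1) ^ card T * (?g (\<Prod>T) - ?g (l * \<Prod>T)) = 0"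
            using nz[OF 1 *] nz[of "l * \<Prod>T" p] * f0 by auto
        qed
      qed (use S in auto)
      also have "\<dots> = real (f n) - real (f m)" using nm l0 by simp
      also have "f n \<le> f m + 1"
        unfolding f_def nm(1) power_mult
      proof (rule multiplicity_power_minus_one_self[OF l])
        show "q ^ m \<ge> 2" using q_pow nm by simp
        show c: "[q ^ m = 1] (mod l)" using dm ord_divides unfolding d_def by metis
        assume l2: "l = 2"
        have oddq: "odd q"
        proof
          assume "even q"
          then have "even (q ^ m)" using nm by simp
          then show False using c l2 by (simp add: cong_def)
        qed
        \<comment> \<open>An odd \<open>q\<close> has order 1 modulo 2, so \<open>k = n\<close>, all
          of whose prime factors are 2. Since \<open>n > 2\<close>, the number
          \<open>m = n / 2\<close> is even and \<open>q ^ m\<close> is an odd square, hence 1 modulo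
          4.\<close>
        have "d = 1" unfolding d_def l2
          using oddq by (simp add: ord_eq_Suc_0_iff cong_def odd_iff_mod_2_eq_one)
        then have "m = j" "k = n" using k by (auto simp: m_def)
        then have "j \<noteq> 1" using n j l2 by auto
        then obtain p where "prime p" "p dvd j" using prime_factor_nat by blast
        then have "even j" using only[of p] j l2 by auto
        then obtain i where i: "m = 2 * i" using \<open>m = j\<close> by blast
        obtain u where u: "q ^ i = 2 * u + 1" using oddq by (metis oddE even_power)
        have "q ^ m = (2 * u + 1) ^ 2" using u i by (simp add: power_mult mult.commute[of 2])
        also have "\<dots> = 1 + 4 * (u * u + u)" by (simp add: power2_eq_square algebra_simps)
        finally show "[q ^ m = 1] (mod 4)" by (simp only: cong_def mod_mult_self2)
      qed
      finally have le1: "moebius_sum ?S ?g \<le> 1" by simp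
      have "p \<le> l" if "p \<in> ?S" for p
      proof (cases "p = l")
        case False
        have p: "prime p" "p dvd d * k" using that k by auto
        then have "p dvd d" using only[of p] False by (auto simp: prime_dvd_mult_iff)
        moreover have "coprime l q" using d0 unfolding d_def by simp
        then have "d dvd l - 1"
          using order_divides_totient[of l q] l by (simp add: d_def totient_prime)
        ultimately have "p dvd l - 1" by (rule dvd_trans)
        moreover have "l - 1 > 0" using l prime_gt_1_nat by fastforce
        ultimately show ?thesis by (auto dest: dvd_imp_le)
      qed simp
      then have "Max ?S = l" using lS by (intro Max_eqI) auto
      then show ?thesis using le1 by simp
    qed
  qed
  then show ?thesis by (simp add: f_def)
qed

section \<open>Zsigmondy's theorem for the bases 2 and 3\<close>

text \<open>Each prime \<open>l\<close> contributes \<open>ln l\<close> times the sum in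
  \<open>moebius_sum_multiplicity_le\<close> to the logarithm of the cyclotomic value. Without a
  prime of order \<open>n\<close>, only the largest prime factor of \<open>n\<close> can contribute
  positively, and at most its logarithm. The lower bound \<open>moebius_sum_ln_ge\<close> is then
  exponentiated.\<close>

lemma power_totient_le_of_no_primitive_prime:
  fixes q n :: nat
  assumes q: "q \<ge> 2" and n: "n > 2" and no: "\<And>l. prime l \<Longrightarrow> ord l q \<noteq> n"
  shows "q ^ totient n \<le> 4 * Max (prime_factors n)"
proof -
  let ?S = "prime_factors n"
  define P where "P = Max ?S"
  define L where "L = {l. prime l \<and> l \<le> q ^ n}"
  have n0: "n > 0" using n by simp
  have finL: "finite L" unfolding L_def by (rule finite_subset[of _ "{..q ^ n}"]) auto
  have "?S \<noteq> {}" using n by (simp add: prime_factorization_empty_iff)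
  then have "P \<in> ?S" unfolding P_def by (intro Max_in) auto
  then have P: "prime P" by auto
  have ln_nonneg: "ln (real l) \<ge> 0" if "prime l" for l
    using prime_ge_1_nat[OF that] by simp
  have "real (totient n) * ln (real q) - ln 4 \<le> moebius_sum ?S (\<lambda>t. ln (real (q ^ (n div t) - 1)))"
    by (rule moebius_sum_ln_ge[OF q n0])
  also have "\<dots> = moebius_sum ?S (\<lambda>t. \<Sum>l\<in>L. ln (real l) * real (multiplicity l (q ^ (n div t) - 1)))"
  proof (rule moebius_sum_cong, rule ln_eq_sum_multiplicity[OF _ finL])
    fix T assume "T \<subseteq> ?S"
    then have "\<Prod>T dvd n" using prod_subset_prime_factors_dvd n0 by blast
    then have nT: "n div \<Prod>T > 0" "n div \<Prod>T \<le> n" using n0 by (auto elim!: dvdE)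
    have "q ^ 1 \<le> q ^ (n div \<Prod>T)" using nT q by (intro power_increasing) auto
    then show pos: "q ^ (n div \<Prod>T) - 1 > 0" using q by simp
    have "q ^ (n div \<Prod>T) \<le> q ^ n" using nT q by (intro power_increasing) auto
    then have "q ^ (n div \<Prod>T) - 1 \<le> q ^ n" by simp
    then show "prime_factors (q ^ (n div \<Prod>T) - 1) \<subseteq> L"
      using pos by (auto simp: L_def prime_factors_dvd dest!: dvd_imp_le)
  qed (auto simp: L_def)
  also have "\<dots> = (\<Sum>l\<in>L. ln (real l) * moebius_sum ?S (\<lambda>t. real (multiplicity l (q ^ (n div t) - 1))))"
    unfolding moebius_sum_def by (simp add: sum_distrib_left mult.left_commute sum.swap[of _ L])
  also have "\<dots> \<le> (\<Sum>l\<in>L. ln (real l) * (if l = P then 1 else 0))"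
    using ln_nonneg q n no unfolding P_def
    by (intro sum_mono mult_left_mono moebius_sum_multiplicity_le) (auto simp: L_def)
  also have "\<dots> \<le> ln (real P)"
    using finL ln_nonneg[OF P] by (simp add: sum.delta if_distrib cong: if_cong)
  finally have "ln (real q ^ totient n) \<le> ln (4 * real P)"
    using q P by (simp add: ln_realpow ln_mult prime_gt_0_nat)
  then have "real (q ^ totient n) \<le> real (4 * P)"
    using q P by (simp add: prime_gt_0_nat)
  then show ?thesis unfolding P_def by (simp only: of_nat_le_iff)
qed

lemma totient_eq_1_cases:
  assumes "totient m = 1"
  shows "m = 1 \<or> m = 2"
proof -
  have "\<not> m > 2" using assms totient_gt_1[of m] by linarith
  moreover have "m \<noteq> 0" using assms totient_0 by (metis zero_neq_one)
  ultimately show ?thesis by linarith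
qed

text \<open>Primitive prime divisors for the exponents that the size estimate in
  \<open>exists_primitive_prime\<close> leaves open: 4, 5, 10 in base 2 and 3, 6 in base 3.\<close>

lemma ord_values:
  "ord 5 (2 :: nat) = 4" "ord 31 (2 :: nat) = 5" "ord 11 (2 :: nat) = 10"
  "ord 13 (3 :: nat) = 3" "ord 7 (3 :: nat) = 6"
  by code_simp+

text \<open>Otherwise \<open>q ^ totient n \<le> 4 * P\<close> for the largest prime factor
  \<open>P\<close> of \<open>n\<close>. As \<open>totient n \<ge> P - 1\<close>, this forces
  \<open>P \<le> 5\<close> and then leaves few \<open>n\<close>, settled by
  \<open>ord_values\<close>. The divisors of \<open>d_const q\<close> include the true exceptions,
  which are 1 and 6 in base 2 and 2 in base 3.\<close>

lemma exists_primitive_prime: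
  fixes q n :: nat
  assumes q: "q \<in> {2, 3}" and n: "\<not> n dvd d_const q" "n > 0"
  shows "\<exists>l. prime l \<and> ord l q = n"
proof (rule ccontr)
  assume "\<not> ?thesis"
  then have no: "\<And>l. prime l \<Longrightarrow> ord l q \<noteq> n" by blast
  have n2: "n > 2" using n q by (cases "n = 1"; cases "n = 2") (auto simp: d_const_def)
  have q2: "q \<ge> 2" using q by auto
  define P where "P = Max (prime_factors n)"
  have bound: "q ^ totient n \<le> 4 * P"
    unfolding P_def using power_totient_le_of_no_primitive_prime[OF q2 n2 no] .
  have "prime_factors n \<noteq> {}" using n2 by (simp add: prime_factorization_empty_iff)
  then have "P \<in> prime_factors n" unfolding P_def by (intro Max_in) auto
  then have P: "prime P" "P dvd n" by auto
  obtain k m where km: "n = P ^ Suc k * m" "\<not> P dvd m"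
  proof -
    obtain m where m: "n = P ^ multiplicity P n * m" "\<not> P dvd m"
      using multiplicity_decompose'[of n P] n(2) P(1) by (metis not_prime_unit neq0_conv)
    moreover have "multiplicity P n > 0" using P n(2) by (simp add: prime_multiplicity_gt_zero_iff)
    ultimately show ?thesis using that by (metis gr0_implies_Suc)
  qed
  have m0: "m > 0" using km by (auto intro: Nat.gr0I)
  have "coprime (P ^ Suc k) m"
    using P km(2) by (simp add: prime_imp_coprime)
  then have tot: "totient n = P ^ k * (P - 1) * totient m"
    using km P by (simp add: totient_mult_coprime totient_prime_power_Suc del: power_Suc)
  have prime_le: "p \<le> P" if "prime p" "p dvd n" for p
    unfolding P_def using that n(2) by (intro Max_ge) (auto simp: prime_factors_dvd)
  have ge1: "P ^ k \<ge> 1" "totient m \<ge> 1" using P m0 by (auto simp: prime_gt_0_nat Suc_leI)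
  have P1: "P \<ge> 2" using P prime_ge_2_nat by blast
  have "(P - 1) * 1 \<le> (P - 1) * (P ^ k * totient m)" using ge1 by (intro mult_left_mono) auto
  then have "P - 1 \<le> totient n" using tot by (simp add: ac_simps)
  then have "q ^ (P - 1) \<le> q ^ totient n" using q2 by (intro power_increasing) auto
  then have qP: "q ^ (P - 1) \<le> 4 * P" using bound by simp
  have grow: "4 * x < 2 ^ (x - 1)" if "x \<ge> 6" for x :: nat
    using that
  proof (induction x rule: dec_induct)
    case (step n)
    then have "2 ^ (Suc n - 1) = 2 * (2::nat) ^ (n - 1)" by (cases n) auto
    then show ?case using step by simp
  qed simp
  have "P \<le> 5"
  proof (rule ccontr)
    assume "\<not> P \<le> 5"
    then have "4 * P < 2 ^ (P - 1)" using grow by simp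
    also have "\<dots> \<le> q ^ (P - 1)" using q2 by (intro power_mono) auto
    finally show False using qP by simp
  qed
  then have "P \<in> {2, 3, 4, 5}" using P1 by auto
  moreover have "P \<noteq> 4" using P(1) by (auto simp: prime_nat_iff dest: spec[of _ 2])
  ultimately have Pc: "P = 2 \<or> P = 3 \<or> P = 5" by auto
  \<comment> \<open>Applied below with the least \<open>t\<close> satisfying
    \<open>4 * P < q ^ t\<close>.\<close>
  have small: "totient n < t" if "4 * P < q ^ t" for t
  proof (rule ccontr)
    assume "\<not> totient n < t"
    then have "q ^ t \<le> q ^ totient n" using q2 by (intro power_increasing) auto
    then show False using that bound by simp
  qed
  have m1: "m = 1" if "P = 2"
  proof (rule ccontr)
    assume "m \<noteq> 1"
    then obtain p where p: "prime p" "p dvd m" using prime_factor_nat by blast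
    then have "p \<le> 2" "p \<ge> 2" using prime_le[of p] that km prime_ge_2_nat by auto
    then show False using p km(2) that by simp
  qed
  have k0: "k = 0" if "p ^ k < p" for p :: nat
  proof (rule ccontr)
    assume "k \<noteq> 0"
    then have "p ^ 1 \<le> p ^ k" using that by (intro power_increasing) auto
    then show False using that by simp
  qed
  have m12: "m = 1 \<or> m = 2" if "totient m = 1" using totient_eq_1_cases that by blast
  from q consider "q = 2" | "q = 3" by blast
  then show False
  proof cases
    case 1
    from Pc show False
    proof (elim disjE)
      assume P2: "P = 2"
      have "totient n < 4" using small[of 4] P2 1 by simp
      then have "2 ^ k < (2::nat) ^ 2" using tot P2 m1 by simp
      then have "k < 2" using power_less_imp_less_exp[of 2 k 2] by simp
      then have "n = 2 \<or> n = 4" using km m1 P2 by (auto simp: less_Suc_eq numeral_2_eq_2)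
      then have "n = 4" using n2 by simp
      then show False using no[of 5] 1 ord_values by simp
    next
      assume P3: "P = 3"
      have "totient n < 4" using small[of 4] P3 1 by simp
      then have *: "3 ^ k * (2 * totient m) < 4" using tot P3 by simp
      have "3 ^ k * 2 \<le> 3 ^ k * (2 * totient m)" using ge1 by simp
      then have "k = 0" using * by (intro k0[of 3]) linarith
      then have "totient m = 1" using * ge1 by simp
      then have "n = 3 \<or> n = 6" using m12 km P3 \<open>k = 0\<close> by auto
      then show False using n 1 by (auto simp: d_const_def)
    next
      assume P5: "P = 5"
      have "totient n < 5" using small[of 5] P5 1 by simp
      then have *: "5 ^ k * (4 * totient m) < 5" using tot P5 by simp
      have "5 ^ k * 4 \<le> 5 ^ k * (4 * totient m)" using ge1 by simp
      then have "k = 0" using * by (intro k0[of 5]) linarith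
      then have "totient m = 1" using * ge1 by simp
      then have "n = 5 \<or> n = 10" using m12 km P5 \<open>k = 0\<close> by auto
      then show False using no[of 31] no[of 11] 1 ord_values by auto
    qed
  next
    case 2
    from Pc show False
    proof (elim disjE)
      assume P2: "P = 2"
      have "totient n < 2" using small[of 2] P2 2 by simp
      then have "2 ^ k < (2::nat) ^ 1" using tot P2 m1 by simp
      then have "k < 1" using power_less_imp_less_exp[of 2 k 1] by simp
      then have "n = 2" using km m1 P2 by auto
      then show False using n2 by simp
    next
      assume P3: "P = 3"
      have "totient n < 3" using small[of 3] P3 2 by simp
      then have *: "3 ^ k * (2 * totient m) < 3" using tot P3 by simp
      have "3 ^ k * 2 \<le> 3 ^ k * (2 * totient m)" using ge1 by simp
      then have "k = 0" using * by (intro k0[of 3]) linarith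
      then have "totient m = 1" using * ge1 by simp
      then have "n = 3 \<or> n = 6" using m12 km P3 \<open>k = 0\<close> by auto
      then show False using no[of 13] no[of 7] 2 ord_values by auto
    next
      assume P5: "P = 5"
      then show False using qP 2 by simp
    qed
  qed
qed

section \<open>Comparison of two products of numbers \<open>q ^ a - 1\<close>\<close>

text \<open>Let \<open>N\<close> be the largest violating exponent and \<open>l\<close> a prime with
  \<open>ord l q = N\<close>. Only multiples of \<open>N\<close> contribute to the exponent of
  \<open>l\<close> in the products. The proper multiples do not divide \<open>d_const q\<close>
  either, so their counts agree by maximality, and comparing exponents of \<open>l\<close> gives
  agreement at \<open>N\<close> too.\<close>

lemma count_eq_of_prod_power_minus_one_eq:
  fixes q n :: nat and A B :: "nat multiset"
  assumes q: "q \<in> {2, 3}" and pos: "\<And>a. a \<in># A + B \<Longrightarrow> a > 0"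
    and eq: "(\<Prod>a\<in>#A. q ^ a - 1) = (\<Prod>b\<in>#B. q ^ b - 1)"
    and n: "\<not> n dvd d_const q"
  shows "count A n = count B n"
proof (rule ccontr)
  assume ne: "count A n \<noteq> count B n"
  define X where "X = {n. \<not> n dvd d_const q \<and> count A n \<noteq> count B n}"
  define M where "M = set_mset (A + B)"
  have finM: "finite M" by (simp add: M_def)
  have XM: "X \<subseteq> M" by (auto simp: X_def M_def) (metis count_eq_zero_iff)+
  define N where "N = Max X"
  have finX: "finite X" using XM finM finite_subset by blast
  have "X \<noteq> {}" using n ne by (auto simp: X_def)
  then have NX: "N \<in> X" using Max_in[OF finX] by (simp add: N_def)
  have Nmax: "x \<notin> X" if "x > N" for x using Max_ge[OF finX, of x] that by (auto simp: N_def)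
  have N: "\<not> N dvd d_const q" "count A N \<noteq> count B N" "N \<in> M" using NX XM by (auto simp: X_def)
  have N0: "N > 0" using N(3) pos by (auto simp: M_def)
  obtain l where l: "prime l" "ord l q = N" using exists_primitive_prime[OF q N(1) N0] by blast
  have q1: "q \<ge> 1" using q by auto
  define f where "f = (\<lambda>m. multiplicity l (q ^ m - 1))"
  have qpow: "q ^ m - 1 > 0" if "m > 0" for m
  proof -
    have "q ^ 1 \<le> q ^ m" using that q1 by (intro power_increasing) auto
    then show ?thesis using q by auto
  qed
  have f0: "f m = 0" if "\<not> N dvd m" for m
    using that dvd_power_minus_one_iff_ord_dvd[OF q1, of l m] l by (simp add: f_def not_dvd_imp_multiplicity_0)
  have "f N > 0"
    using dvd_power_minus_one_iff_ord_dvd[OF q1, of l N] l qpow[OF N0] 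
    by (simp add: f_def prime_multiplicity_gt_zero_iff)
  have val: "multiplicity l (\<Prod>a\<in>#C. q ^ a - 1) = (\<Sum>m\<in>M. count C m * f m)" if "set_mset C \<subseteq> M" for C
  proof -
    have "multiplicity l (\<Prod>a\<in>#C. q ^ a - 1) = (\<Sum>a\<in>#C. f a)"
    proof -
      have "0 \<notin> set_mset (image_mset (\<lambda>a. q ^ a - 1) C)"
      proof
        assume "0 \<in># image_mset (\<lambda>a. q ^ a - 1) C"
        then obtain a where a: "a \<in># C" "q ^ a - 1 = 0" by auto
        then have "a > 0" using that pos by (auto simp: M_def)
        then show False using qpow[of a] a(2) by simp
      qed
      then show ?thesis using l(1)
        by (subst prime_elem_multiplicity_prod_mset_distrib) (auto simp: f_def image_mset.compositionality comp_def)
    qed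
    also have "\<dots> = (\<Sum>m\<in>M. count C m * f m)"
      using that
    proof (induction C)
      case (add x C)
      have "(\<Sum>m\<in>M. count (add_mset x C) m * f m) = (\<Sum>m\<in>M. count C m * f m + (if m = x then f x else 0))"
        by (rule sum.cong) auto
      also have "\<dots> = (\<Sum>m\<in>M. count C m * f m) + f x"
        using add finM by (simp add: sum.distrib)
      finally show ?case using add by simp
    qed simp
    finally show ?thesis .
  qed
  have "(\<Sum>m\<in>M. count A m * f m) = (\<Sum>m\<in>M. count B m * f m)"
    using val[of A] val[of B] eq by (simp add: M_def)
  moreover have "(\<Sum>m\<in>M - {N}. count A m * f m) = (\<Sum>m\<in>M - {N}. count B m * f m)"
  proof (rule sum.cong)
    fix m assume m: "m \<in> M - {N}"
    show "count A m * f m = count B m * f m"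
    proof (cases "N dvd m")
      case True
      then have "m > N" using m pos dvd_imp_le[of N m] by (fastforce simp: M_def)
      moreover have "\<not> m dvd d_const q" using True N(1) dvd_trans by blast
      ultimately show ?thesis using Nmax[of m] by (simp add: X_def)
    qed (simp add: f0)
  qed simp
  ultimately have "count A N * f N = count B N * f N"
    using sum.remove[OF finM N(3), of "\<lambda>m. count A m * f m"] sum.remove[OF finM N(3), of "\<lambda>m. count B m * f m"]
    by simp
  then show False using \<open>f N > 0\<close> N(2) by simp
qed

section \<open>Factorization in polynomial rings over finite fields\<close>

lemma prime_poly_monic: "prime_poly P \<Longrightarrow> lead_coeff P = 1"
  by (simp add: prime_poly_def)

lemma prime_poly_nonzero: "prime_poly P \<Longrightarrow> P \<noteq> 0"
  using prime_poly_monic by force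

lemma prime_poly_prime_elem: "prime_poly P \<Longrightarrow> prime_elem P"
  by (simp add: prime_poly_def field_poly_irreducible_imp_prime)

lemma prime_poly_degree_pos:
  assumes "prime_poly P"
  shows "degree P > 0"
proof (rule Nat.gr0I)
  assume "degree P = 0"
  then have "is_unit P" using prime_poly_nonzero[OF assms] is_unit_iff_degree by blast
  then show False using assms by (simp add: prime_poly_def irreducible_not_unit)
qed

lemma monic_degree_0: "lead_coeff F = 1 \<Longrightarrow> degree F = 0 \<Longrightarrow> F = 1"
  by (metis degree_eq_zeroE lead_coeff_pCons(2) one_pCons)

lemma monic_mult_cancel:
  fixes A B :: "'a::{field,finite} poly"
  shows "lead_coeff (A * B) = 1 \<Longrightarrow> lead_coeff A = 1 \<Longrightarrow> lead_coeff B = 1"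
  by (simp add: lead_coeff_mult)

lemma monic_power_prime_poly: "prime_poly P \<Longrightarrow> lead_coeff (P ^ k) = 1"
  by (simp add: lead_coeff_power prime_poly_monic)

lemma monic_prod_prime_power:
  "(\<And>P. P \<in> S \<Longrightarrow> prime_poly P) \<Longrightarrow> lead_coeff (\<Prod>P\<in>S. P ^ e P) = 1"
  by (induction S rule: infinite_finite_induct) (auto simp: lead_coeff_mult monic_power_prime_poly)

lemma prime_poly_dvd_imp_eq:
  assumes "prime_poly P" "prime_poly Q" "P dvd Q"
  shows "P = Q"
proof -
  obtain c where c: "Q = P * c" using assms(3) by blast
  have "\<not> is_unit P" using assms(1) by (simp add: prime_poly_def irreducible_not_unit)
  then have "is_unit c" using assms(2) irreducibleD[of Q P c] c by (auto simp: prime_poly_def)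
  then have "degree c = 0" using is_unit_iff_degree[of c] by force
  moreover have "lead_coeff c = 1" using monic_mult_cancel c assms prime_poly_monic by metis
  ultimately show ?thesis using c monic_degree_0 by force
qed

lemma prime_poly_dvd_prod_iff:
  assumes "finite S" "\<And>Q. Q \<in> S \<Longrightarrow> prime_poly Q" "prime_poly P" "\<And>Q. Q \<in> S \<Longrightarrow> e Q > 0"
  shows "P dvd (\<Prod>Q\<in>S. Q ^ e Q) \<longleftrightarrow> P \<in> S"
proof
  assume dvd: "P dvd (\<Prod>Q\<in>S. Q ^ e Q)"
  have "\<exists>Q\<in>S. P dvd Q ^ e Q"
    using assms(1) dvd
  proof (induction S rule: finite_induct)
    case empty
    then show ?case using prime_poly_prime_elem[OF assms(3)] by (simp add: prime_elem_def)
  next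
    case (insert Q S)
    then show ?case
      using prime_elem_dvd_multD[OF prime_poly_prime_elem[OF assms(3)]] by auto
  qed
  then obtain Q where "Q \<in> S" "P dvd Q ^ e Q" by blast
  then show "P \<in> S"
    using assms prime_poly_dvd_imp_eq prime_elem_dvd_power prime_poly_prime_elem by metis
next
  assume P: "P \<in> S"
  have "P dvd P ^ e P" using assms(4)[OF P] by (simp add: dvd_power)
  also have "\<dots> dvd (\<Prod>Q\<in>S. Q ^ e Q)" using assms(1) P by (intro dvd_prodI)
  finally show "P dvd (\<Prod>Q\<in>S. Q ^ e Q)" .
qed

lemma exists_prime_poly_dvd:
  fixes F :: "'a::{field,finite} poly"
  assumes "F \<noteq> 0" "degree F > 0"
  shows "\<exists>P. prime_poly P \<and> P dvd F"
  using assms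
proof (induction "degree F" arbitrary: F rule: less_induct)
  case less
  show ?case
  proof (cases "irreducible F")
    case True
    define c where "c = inverse (lead_coeff F)"
    have c: "c \<noteq> 0" using less by (simp add: c_def)
    have "irreducible (Polynomial.smult c F)"
    proof -
      have "Polynomial.smult c F = [:c:] * F" by simp
      moreover have "is_unit [:c:]" using c by (simp add: is_unit_pCons_iff)
      ultimately show ?thesis using True by (simp only: irreducible_mult_unit_left)
    qed
    moreover have "lead_coeff (Polynomial.smult c F) = 1" using less by (simp add: c_def)
    moreover have "Polynomial.smult c F dvd F" using c by (simp add: smult_dvd_iff)
    ultimately show ?thesis unfolding prime_poly_def by blast
  next
    case False
    have "\<not> is_unit F" using less(2,3) is_unit_iff_degree[of F] by simp
    then obtain A B where AB: "F = A * B" "\<not> is_unit A" "\<not> is_unit B"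
      using False less by (auto simp: irreducible_def)
    then have nz: "A \<noteq> 0" "B \<noteq> 0" using less by auto
    then have "degree A > 0" "degree B > 0" using AB is_unit_iff_degree[of A] is_unit_iff_degree[of B] by auto
    then have "degree A < degree F" using AB nz by (simp add: degree_mult_eq)
    then obtain P where "prime_poly P" "P dvd A"
      using less(1)[of A] nz \<open>degree A > 0\<close> by blast
    then show ?thesis using AB by auto
  qed
qed

lemma exists_prime_poly_factorization:
  fixes F :: "'a::{field,finite} poly"
  assumes "lead_coeff F = 1"
  shows "\<exists>S e. finite S \<and> (\<forall>P\<in>S. prime_poly P \<and> e P > 0) \<and> F = (\<Prod>P\<in>S. P ^ e P)"
  using assms
proof (induction "degree F" arbitrary: F rule: less_induct)
  case less
  show ?case
  proof (cases "degree F = 0")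
    case True
    then have "F = 1" using less(2) monic_degree_0 by blast
    then show ?thesis by (intro exI[of _ "{}"]) simp
  next
    case False
    have "F \<noteq> 0" using less(2) by auto
    then obtain P where P: "prime_poly P" "P dvd F" using exists_prime_poly_dvd False by blast
    then obtain B where B: "F = P * B" by blast
    have nz: "P \<noteq> 0" "B \<noteq> 0" using \<open>F \<noteq> 0\<close> B by auto
    have "degree B < degree F"
      using B nz prime_poly_degree_pos[OF P(1)] by (simp add: degree_mult_eq)
    moreover have "lead_coeff B = 1" using monic_mult_cancel less(2) B P prime_poly_monic by metis
    ultimately obtain S e where S: "finite S" "\<forall>P\<in>S. prime_poly P \<and> e P > 0" "B = (\<Prod>P\<in>S. P ^ e P)"
      using less(1) by blast
    \<comment> \<open>The exponent of \<open>P\<close> goes up by one; outside \<open>S\<close> the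
      values of \<open>e\<close> are arbitrary and are replaced by 0, which covers the case that
      \<open>P\<close> is new.\<close>
    define e' where "e' = (\<lambda>Q. (if Q \<in> S then e Q else 0) + (if Q = P then 1 else 0 :: nat))"
    have "(\<Prod>Q\<in>insert P S. Q ^ e' Q)
        = (\<Prod>Q\<in>insert P S. Q ^ (if Q \<in> S then e Q else 0)) * (\<Prod>Q\<in>insert P S. Q ^ (if Q = P then 1 else 0))"
      by (simp add: e'_def power_add prod.distrib)
    also have "(\<Prod>Q\<in>insert P S. Q ^ (if Q = P then 1 else 0)) = (\<Prod>Q\<in>{P}. Q)"
      using S(1) by (intro prod.mono_neutral_cong_right) auto
    also have "(\<Prod>Q\<in>insert P S. Q ^ (if Q \<in> S then e Q else 0)) = B"
      unfolding S(3) using S(1) by (intro prod.mono_neutral_cong_right) auto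
    finally have "F = (\<Prod>Q\<in>insert P S. Q ^ e' Q)" by (simp add: B mult.commute)
    then show ?thesis
      using S P by (intro exI[of _ "insert P S"] exI[of _ e']) (auto simp: e'_def)
  qed
qed

section \<open>The functions phi and sigma on prime factorizations\<close>

lemma v_poly_prime_power_mult:
  assumes "prime_poly P" "\<not> P dvd B"
  shows "v_poly P (P ^ k * B) = k"
proof -
  have "P ^ j dvd P ^ k * B \<longleftrightarrow> j \<le> k" for j
  proof
    assume j: "P ^ j dvd P ^ k * B"
    show "j \<le> k"
    proof (rule ccontr)
      assume "\<not> j \<le> k"
      then have "P ^ Suc k dvd P ^ j" by (intro le_imp_power_dvd) auto
      then have "P ^ k * P dvd P ^ k * B" using j dvd_trans by (metis power_Suc2)
      then show False using assms prime_poly_nonzero[OF assms(1)] by simp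
    qed
  qed (simp add: le_imp_power_dvd)
  then have "{j. P ^ j dvd P ^ k * B} = {..k}" by auto
  then show ?thesis unfolding v_poly_def by (simp add: Max_eq_iff)
qed

lemma phi_poly_prod:
  assumes S: "finite S" "\<And>P. P \<in> S \<Longrightarrow> prime_poly P" "\<And>P. P \<in> S \<Longrightarrow> e P > 0"
  shows "phi_poly (\<Prod>P\<in>S. P ^ e P) = (\<Prod>P\<in>S. abs_poly P ^ (e P - 1) * (abs_poly P - 1))"
proof -
  let ?F = "\<Prod>P\<in>S. P ^ e P"
  have "P dvd ?F \<longleftrightarrow> P \<in> S" if "prime_poly P" for P
    by (rule prime_poly_dvd_prod_iff) (use S that in auto)
  then have "{P. prime_poly P \<and> P dvd ?F} = S"
    using S(2) by auto
  moreover have "v_poly P ?F = e P" if P: "P \<in> S" for P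
  proof -
    have "\<not> P dvd (\<Prod>Q\<in>S - {P}. Q ^ e Q)"
      using S P prime_poly_dvd_prod_iff[of "S - {P}" P e] by auto
    moreover have "?F = P ^ e P * (\<Prod>Q\<in>S - {P}. Q ^ e Q)" using prod.remove[OF S(1) P] .
    ultimately show ?thesis using v_poly_prime_power_mult[OF S(2)[OF P]] by metis
  qed
  ultimately show ?thesis unfolding phi_poly_def by simp
qed

text \<open>Induction on \<open>k\<close>: if \<open>P\<close> divides \<open>D\<close>, one factor
  \<open>P\<close> is cancelled on both sides; otherwise \<open>P\<close> divides the cofactor by
  primality and is cancelled there.\<close>

lemma dvd_prime_power_mult_cases:
  assumes P: "prime_poly P" and nd: "\<not> P dvd B" and D: "D dvd P ^ k * B"
  shows "\<exists>i\<le>k. \<exists>C. D = P ^ i * C \<and> C dvd B"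
  using D
proof (induction k arbitrary: D)
  case 0
  then show ?case by (intro exI[of _ 0]) auto
next
  case (Suc k)
  show ?case
  proof (cases "P dvd D")
    case True
    then obtain D' where D': "D = P * D'" by blast
    then have "P * D' dvd P * (P ^ k * B)" using Suc(2) by (simp add: mult.assoc)
    then have "D' dvd P ^ k * B" using prime_poly_nonzero[OF P] by simp
    then obtain i C where "i \<le> k" "D' = P ^ i * C" "C dvd B" using Suc(1) by blast
    then show ?thesis using D' by (intro exI[of _ "Suc i"] conjI exI[of _ C]) (auto simp: mult.assoc)
  next
    case False
    obtain y where y: "P * (P ^ k * B) = D * y" using Suc(2) by (auto simp: mult.assoc)
    then have "P dvd D * y" by (metis dvd_triv_left)
    then have "P dvd y" using False prime_elem_dvd_multD[OF prime_poly_prime_elem[OF P]] by blast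
    then obtain z where "y = P * z" by blast
    then have "P * (P ^ k * B) = P * (D * z)" using y by (simp add: mult.left_commute)
    then have "D dvd P ^ k * B" using prime_poly_nonzero[OF P] by simp
    then show ?thesis using Suc(1)[of D] le_SucI by blast
  qed
qed

lemma abs_poly_mult: "A \<noteq> 0 \<Longrightarrow> B \<noteq> 0 \<Longrightarrow> abs_poly (A * B) = abs_poly A * abs_poly B"
  by (simp add: abs_poly_def degree_mult_eq power_add)

lemma abs_poly_power: "A \<noteq> 0 \<Longrightarrow> abs_poly (A ^ k) = abs_poly A ^ k"
  by (simp add: abs_poly_def degree_power_eq power_mult[symmetric] mult.commute)

text \<open>The monic divisors of \<open>P ^ k * B\<close> are the products \<open>P ^ i * C\<close>
  with \<open>i \<le> k\<close> and \<open>C\<close> a monic divisor of \<open>B\<close>. The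
  representation is unique, since \<open>i\<close> is the exponent of \<open>P\<close>.\<close>

lemma sigma_poly_prime_power_mult:
  assumes P: "prime_poly P" and nd: "\<not> P dvd B" and B: "B \<noteq> 0"
  shows "sigma_poly (P ^ k * B) = (\<Sum>i\<le>k. abs_poly P ^ i) * sigma_poly B"
proof -
  let ?D = "{D. monic_poly D \<and> D dvd B}"
  let ?f = "\<lambda>(i, D). P ^ i * D"
  have P0: "P \<noteq> 0" using P prime_poly_nonzero by blast
  have "{D. monic_poly D \<and> D dvd P ^ k * B} = ?f ` ({..k} \<times> ?D)"
  proof (intro equalityI subsetI)
    fix D assume "D \<in> {D. monic_poly D \<and> D dvd P ^ k * B}"
    then have D: "lead_coeff D = 1" "D dvd P ^ k * B" by auto
    then obtain i C where iC: "i \<le> k" "D = P ^ i * C" "C dvd B"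
      using dvd_prime_power_mult_cases[OF P nd] by blast
    have "lead_coeff C = 1" using D iC monic_power_prime_poly[OF P] monic_mult_cancel by metis
    then show "D \<in> ?f ` ({..k} \<times> ?D)" using iC by (intro image_eqI[of _ _ "(i, C)"]) auto
  next
    fix D assume "D \<in> ?f ` ({..k} \<times> ?D)"
    then obtain i C where "i \<le> k" "D = P ^ i * C" "C dvd B" "lead_coeff C = 1" by auto
    then show "D \<in> {D. monic_poly D \<and> D dvd P ^ k * B}"
      using monic_power_prime_poly[OF P] by (auto simp: lead_coeff_mult intro!: mult_dvd_mono le_imp_power_dvd)
  qed
  moreover have "inj_on ?f ({..k} \<times> ?D)"
  proof (rule inj_onI, clarsimp)
    fix i j C D assume CD: "C dvd B" "D dvd B" and eq: "P ^ i * C = P ^ j * D"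
    have "\<not> P dvd C" "\<not> P dvd D" using CD nd dvd_trans by blast+
    then have "i = j" using v_poly_prime_power_mult[OF P] eq by metis
    then show "i = j \<and> C = D" using eq P0 by simp
  qed
  ultimately have "sigma_poly (P ^ k * B) = (\<Sum>x\<in>{..k} \<times> ?D. abs_poly (?f x))"
    unfolding sigma_poly_def by (simp add: sum.reindex)
  also have "\<dots> = (\<Sum>(i, D)\<in>{..k} \<times> ?D. abs_poly P ^ i * abs_poly D)"
  proof (rule sum.cong)
    fix x assume "x \<in> {..k} \<times> ?D"
    then obtain i D where "x = (i, D)" "D dvd B" by auto
    moreover from this have "D \<noteq> 0" using B by auto
    ultimately show "abs_poly (?f x) = (case x of (i, D) \<Rightarrow> abs_poly P ^ i * abs_poly D)"
      using P0 by (simp add: abs_poly_mult abs_poly_power)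
  qed simp
  also have "\<dots> = (\<Sum>i\<le>k. abs_poly P ^ i) * sigma_poly B"
    unfolding sigma_poly_def sum_product sum.cartesian_product ..
  finally show ?thesis .
qed

lemma sigma_poly_one: "sigma_poly (1 :: 'a::{field,finite} poly) = 1"
proof -
  have "{D :: 'a poly. monic_poly D \<and> D dvd 1} = {1}"
  proof (intro equalityI subsetI)
    fix D :: "'a poly" assume D: "D \<in> {D. monic_poly D \<and> D dvd 1}"
    then have "degree D = 0" using is_unit_iff_degree[of D] by (cases "D = 0") auto
    then show "D \<in> {1}" using D monic_degree_0 by blast
  qed auto
  then show ?thesis unfolding sigma_poly_def by (simp add: abs_poly_def)
qed

lemma sigma_poly_prod:
  fixes S :: "'a::{field,finite} poly set"
  assumes S: "finite S" "\<And>P. P \<in> S \<Longrightarrow> prime_poly P" "\<And>P. P \<in> S \<Longrightarrow> e P > 0"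
  shows "sigma_poly (\<Prod>P\<in>S. P ^ e P) = (\<Prod>P\<in>S. \<Sum>i\<le>e P. abs_poly P ^ i)"
  using assms
proof (induction S rule: finite_induct)
  case empty
  then show ?case by (simp add: sigma_poly_one)
next
  case (insert P S)
  have "\<not> P dvd (\<Prod>Q\<in>S. Q ^ e Q)"
    using insert prime_poly_dvd_prod_iff[of S P e] by auto
  moreover have "(\<Prod>Q\<in>S. Q ^ e Q) \<noteq> 0"
    using monic_prod_prime_power[of S e] insert(4) by (metis insertCI leading_coeff_0_iff zero_neq_one)
  ultimately show ?case
    using insert by (simp add: sigma_poly_prime_power_mult)
qed

lemma finite_degree_le: "finite {p :: 'a::{field,finite} poly. degree p \<le> N}"
proof (rule finite_subset)
  show "{p :: 'a poly. degree p \<le> N} \<subseteq> Poly ` {xs. set xs \<subseteq> UNIV \<and> length xs \<le> Suc N}"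
  proof
    fix p :: "'a poly" assume "p \<in> {p. degree p \<le> N}"
    then have "length (coeffs p) \<le> Suc N" by (cases "p = 0") (auto simp: length_coeffs_degree)
    then show "p \<in> Poly ` {xs. set xs \<subseteq> UNIV \<and> length xs \<le> Suc N}"
      by (intro image_eqI[of _ _ "coeffs p"]) auto
  qed
  show "finite (Poly ` {xs :: 'a list. set xs \<subseteq> UNIV \<and> length xs \<le> Suc N})"
    by (intro finite_imageI finite_lists_length_le) simp
qed

section \<open>Chains\<close>

text \<open>The case \<open>m = 0\<close>: every chain starts as a single prime of \<open>F\<close>
  and grows by \<open>V_set_prepend\<close>.\<close>

lemma V_set_singleton:
  assumes "prime_poly P"
  shows "(P, 1) \<in> V_set [degree P]"
  unfolding V_set_def using assms by (auto intro!: exI[of _ "\<lambda>_. P"])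

text \<open>Chains grow at the lower end. The old first entry \<open>degree Q * (k + 1)\<close>
  becomes \<open>degree Q\<close> times the factor \<open>k + 1\<close> of the new second entry, so
  the degrees required of the old primes are unchanged.\<close>

lemma V_set_prepend:
  fixes F G Q :: "'a::{field,finite} poly"
  assumes Q: "prime_poly Q" and V: "(F, G) \<in> V_set (degree Q * (k + 1) # vs)"
  shows "(F, Q ^ k * G) \<in> V_set (degree Q # k # vs)"
proof -
  let ?v = "degree Q * (k + 1) # vs" and ?w = "degree Q # k # vs"
  obtain P where P: "\<And>i. i \<in> {1..length ?v} \<Longrightarrow> prime_poly (P i) \<and> degree (P i) = ?v ! 0 * (\<Prod>j=1..<i. ?v ! j + 1)"
    and G: "G = (\<Prod>i=1..<length ?v. P i ^ (?v ! i))" and F: "F = P (length ?v)"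
    using V unfolding V_set_def by blast
  define R where "R = (\<lambda>i. if i = 1 then Q else P (i - 1))"
  \<comment> \<open>This fails for \<open>j = 0\<close>: entry 0 of the old tuple is replaced by two
    entries, and only the later ones are shifted.\<close>
  have shift: "?w ! Suc j = ?v ! j" if "j \<ge> 1" for j using that by (cases j) auto
  have "prime_poly (R i) \<and> degree (R i) = ?w ! 0 * (\<Prod>j=1..<i. ?w ! j + 1)" if i: "i \<in> {1..length ?w}" for i
  proof (cases "i = 1")
    case True
    then show ?thesis using Q by (simp add: R_def)
  next
    case False
    then obtain m where m: "i = Suc m" "m \<ge> 1" using i by (cases i) auto
    have "(\<Prod>j=1..<i. ?w ! j + 1) = (?w ! 1 + 1) * (\<Prod>j=Suc 1..<Suc m. ?w ! j + 1)"
      using m by (subst prod.atLeast_Suc_lessThan) auto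
    also have "(\<Prod>j=Suc 1..<Suc m. ?w ! j + 1) = (\<Prod>j=1..<m. ?v ! j + 1)"
      unfolding prod.shift_bounds_Suc_ivl by (rule prod.cong) (use shift in auto)
    finally have "?w ! 0 * (\<Prod>j=1..<i. ?w ! j + 1) = ?v ! 0 * (\<Prod>j=1..<m. ?v ! j + 1)"
      by (simp only: nth_Cons_0 nth_Cons_Suc One_nat_def mult.assoc)
    then show ?thesis using P[of m] m i by (simp add: R_def)
  qed
  moreover have "Q ^ k * G = (\<Prod>i=1..<length ?w. R i ^ (?w ! i))"
  proof -
    have "(\<Prod>i=1..<length ?w. R i ^ (?w ! i)) = R 1 ^ (?w ! 1) * (\<Prod>i=Suc 1..<Suc (length ?v). R i ^ (?w ! i))"
      by (subst prod.atLeast_Suc_lessThan) auto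
    also have "(\<Prod>i=Suc 1..<Suc (length ?v). R i ^ (?w ! i)) = G"
      unfolding prod.shift_bounds_Suc_ivl G by (rule prod.cong) (use shift in \<open>auto simp: R_def\<close>)
    finally show ?thesis by (simp add: R_def)
  qed
  moreover have "F = R (length ?w)" by (simp add: R_def F)
  ultimately show ?thesis unfolding V_set_def by blast
qed

text \<open>
  The chain ending in the prime \<open>P \<in> A\<close> has tuple \<open>v P\<close> and uses the primes \<open>c P\<close>; the primes in \<open>R\<close> are not
  yet used. The counting condition lets a chain be extended downwards by a prime of \<open>R\<close> whose value
  \<open>degree Q * (e Q + 1)\<close> is maximal among those not dividing \<open>d\<close>.
\<close>

definition chain_system ::
  "nat \<Rightarrow> ('a::{field,finite} poly \<Rightarrow> nat) \<Rightarrow> 'a poly set \<Rightarrow> 'a poly set \<Rightarrow>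
    ('a poly \<Rightarrow> nat list) \<Rightarrow> ('a poly \<Rightarrow> 'a poly set) \<Rightarrow> bool" where
  "chain_system d e A R v c \<longleftrightarrow>
     (\<forall>P\<in>A. v P \<noteq> [] \<and> (\<forall>x\<in>set (v P). x > 0) \<and> (P, \<Prod>Q\<in>c P. Q ^ e Q) \<in> V_set (v P)
        \<and> finite (c P) \<and> c P \<inter> R = {}) \<and>
     (\<forall>P\<in>A. \<forall>P'\<in>A. P \<noteq> P' \<longrightarrow> c P \<inter> c P' = {}) \<and>
     (\<forall>n. \<not> n dvd d \<longrightarrow>
        (\<Sum>P\<in>A. of_bool (v P ! 0 = n)) + (\<Sum>Q\<in>R. of_bool (degree Q = n))
          = (\<Sum>Q\<in>R. of_bool (degree Q * (e Q + 1) = n) :: nat))"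

lemma chain_system_complete:
  fixes A R :: "'a::{field,finite} poly set"
  assumes "finite A" "finite R" "\<And>Q. Q \<in> R \<Longrightarrow> prime_poly Q \<and> e Q > 0" "chain_system d e A R v c"
  shows "\<exists>v' c' R'. R' \<subseteq> R \<and> chain_system d e A R' v' c' \<and>
    (\<forall>P\<in>A. v' P ! 0 dvd d) \<and> (\<forall>Q\<in>R'. degree Q * (e Q + 1) dvd d) \<and>
    (\<Union>P\<in>A. c' P) \<union> R' = (\<Union>P\<in>A. c P) \<union> R"
  using assms(2,3,4)
proof (induction "card R" arbitrary: R v c rule: less_induct)
  case less
  let ?out = "\<lambda>Q. degree Q * (e Q + 1)"
  note cs = less(4)[unfolded chain_system_def]
  show ?case
  proof (cases "\<forall>Q\<in>R. ?out Q dvd d")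
    case True
    have "v P ! 0 dvd d" if P: "P \<in> A" for P
    proof (rule ccontr)
      assume nd: "\<not> v P ! 0 dvd d"
      have "(\<Sum>Q\<in>R. of_bool (?out Q = v P ! 0) :: nat) = 0" using True nd less(2) by auto
      moreover have "(\<Sum>P'\<in>A. of_bool (v P' ! 0 = v P ! 0)) + (\<Sum>Q\<in>R. of_bool (degree Q = v P ! 0))
          = (\<Sum>Q\<in>R. of_bool (?out Q = v P ! 0) :: nat)"
        using cs nd by blast
      ultimately have "(\<Sum>P'\<in>A. of_bool (v P' ! 0 = v P ! 0) :: nat) = 0" by linarith
      then show False using P assms(1) by auto
    qed
    then show ?thesis using True less(4) by blast
  next
    case False
    define X where "X = {Q\<in>R. \<not> ?out Q dvd d}"
    have X: "finite X" "X \<noteq> {}" using False less(2) by (auto simp: X_def)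
    then obtain Q where "Q \<in> X" and Qmax: "\<And>Q'. Q' \<in> X \<Longrightarrow> ?out Q' \<le> ?out Q"
    proof -
      have "Max (?out ` X) \<in> ?out ` X" using X by (intro Max_in) auto
      then obtain Q where "Q \<in> X" "Max (?out ` X) = ?out Q" by blast
      moreover have "?out Q' \<le> Max (?out ` X)" if "Q' \<in> X" for Q' using X that by (intro Max_ge) auto
      ultimately show ?thesis using that by metis
    qed
    then have Q: "Q \<in> R" "\<not> ?out Q dvd d" "prime_poly Q" "e Q > 0" using less(3) by (auto simp: X_def)
    define n where "n = ?out Q"
    \<comment> \<open>A prime of degree \<open>n\<close> in \<open>R\<close> would have as its own
      value a proper multiple of \<open>n\<close>, which does not divide \<open>d\<close> either,
      against maximality. So the count can only be met by a chain with first entry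
      \<open>n\<close>.\<close>
    have none: "degree Q' \<noteq> n" if "Q' \<in> R" for Q'
    proof
      assume deg: "degree Q' = n"
      then have "\<not> ?out Q' dvd d" using Q(2) unfolding n_def by (metis dvd_mult_left)
      then have "?out Q' \<le> n" using Qmax[of Q'] that unfolding X_def n_def by blast
      moreover have "n > 0" using Q prime_poly_degree_pos unfolding n_def by auto
      ultimately show False using deg less(3)[OF that] by simp
    qed
    have "(\<Sum>P\<in>A. of_bool (v P ! 0 = n) :: nat) + (\<Sum>Q\<in>R. of_bool (degree Q = n))
        = (\<Sum>Q\<in>R. of_bool (?out Q = n))"
      using cs Q(2) unfolding n_def by blast
    moreover have "(\<Sum>Q\<in>R. of_bool (degree Q = n) :: nat) = 0" using none by simp
    moreover have "(\<Sum>Q\<in>R. of_bool (?out Q = n) :: nat) \<noteq> 0" using Q(1) less(2) by (auto simp: n_def)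
    ultimately have "(\<Sum>P\<in>A. of_bool (v P ! 0 = n) :: nat) \<noteq> 0" by linarith
    have "\<exists>P\<in>A. v P ! 0 = n"
    proof (rule ccontr)
      assume "\<not> ?thesis"
      then have "(\<Sum>P\<in>A. of_bool (v P ! 0 = n) :: nat) = 0" by simp
      then show False using \<open>(\<Sum>P\<in>A. of_bool (v P ! 0 = n) :: nat) \<noteq> 0\<close> by contradiction
    qed
    then obtain P where P: "P \<in> A" "v P ! 0 = n" by blast
    define v1 where "v1 = v(P := degree Q # e Q # tl (v P))"
    define c1 where "c1 = c(P := insert Q (c P))"
    define R1 where "R1 = R - {Q}"
    have vP: "v P = n # tl (v P)" using cs P by (metis list.collapse hd_conv_nth)
    have QcP: "Q \<notin> c P'" if "P' \<in> A" for P' using cs that Q(1) by blast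
    have "chain_system d e A R1 v1 c1"
      unfolding chain_system_def
    proof (intro conjI ballI allI impI)
      fix P' assume P': "P' \<in> A"
      show "v1 P' \<noteq> []" using cs P' by (auto simp: v1_def)
      show "finite (c1 P')" using cs P' by (auto simp: c1_def)
      show "c1 P' \<inter> R1 = {}" using cs P' by (auto simp: c1_def R1_def)
      show "(P', \<Prod>Q\<in>c1 P'. Q ^ e Q) \<in> V_set (v1 P')"
      proof (cases "P' = P")
        case True
        have "(P, \<Prod>Q\<in>c P. Q ^ e Q) \<in> V_set (n # tl (v P))" using cs P vP by metis
        then have "(P, Q ^ e Q * (\<Prod>Q\<in>c P. Q ^ e Q)) \<in> V_set (degree Q # e Q # tl (v P))"
          using V_set_prepend[OF Q(3)] unfolding n_def by blast
        moreover have "finite (c P)" using cs P by blast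
        ultimately show ?thesis using True QcP[OF P(1)] by (simp add: v1_def c1_def)
      qed (use cs P' in \<open>simp add: v1_def c1_def\<close>)
      fix x assume x: "x \<in> set (v1 P')"
      show "x > 0"
      proof (cases "P' = P")
        case True
        then have "x = degree Q \<or> x = e Q \<or> x \<in> set (tl (v P))" using x by (simp add: v1_def)
        moreover have "set (tl (v P)) \<subseteq> set (v P)" by (subst (2) vP) auto
        ultimately show ?thesis using cs P Q prime_poly_degree_pos by blast
      qed (use cs P' x in \<open>auto simp: v1_def\<close>)
    next
      fix P1 P2 assume P12: "P1 \<in> A" "P2 \<in> A" "P1 \<noteq> P2"
      then have "c P1 \<inter> c P2 = {}" using cs by blast
      then show "c1 P1 \<inter> c1 P2 = {}" using P12 QcP by (auto simp: c1_def)
    next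
      fix m assume m: "\<not> m dvd d"
      have "(\<Sum>P\<in>A. of_bool (v1 P ! 0 = m)) = of_bool (degree Q = m) + (\<Sum>P\<in>A - {P}. of_bool (v P ! 0 = m) :: nat)"
        using assms(1) P by (subst sum.remove[of A P]) (auto simp: v1_def)
      moreover have "(\<Sum>P\<in>A. of_bool (v P ! 0 = m)) = of_bool (n = m) + (\<Sum>P\<in>A - {P}. of_bool (v P ! 0 = m) :: nat)"
        using assms(1) P by (subst sum.remove[of A P]) auto
      moreover have "(\<Sum>Q\<in>R. of_bool (degree Q = m)) = of_bool (degree Q = m) + (\<Sum>Q\<in>R1. of_bool (degree Q = m) :: nat)"
        unfolding R1_def by (rule sum.remove[OF less(2) Q(1)])
      moreover have "(\<Sum>Q\<in>R. of_bool (?out Q = m)) = of_bool (n = m) + (\<Sum>Q\<in>R1. of_bool (?out Q = m) :: nat)"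
        unfolding R1_def n_def by (rule sum.remove[OF less(2) Q(1)])
      moreover have "(\<Sum>P\<in>A. of_bool (v P ! 0 = m)) + (\<Sum>Q\<in>R. of_bool (degree Q = m))
          = (\<Sum>Q\<in>R. of_bool (?out Q = m) :: nat)"
        using cs m by blast
      ultimately show "(\<Sum>P\<in>A. of_bool (v1 P ! 0 = m)) + (\<Sum>Q\<in>R1. of_bool (degree Q = m))
          = (\<Sum>Q\<in>R1. of_bool (?out Q = m) :: nat)"
        by linarith
    qed
    moreover have "card R1 < card R" "finite R1"
      using card_Diff1_less[OF less(2) Q(1)] less(2) by (simp_all only: R1_def finite_Diff)
    moreover have "\<And>Q. Q \<in> R1 \<Longrightarrow> prime_poly Q \<and> e Q > 0" using less(3) by (simp add: R1_def)
    ultimately obtain v' c' R' where IH: "R' \<subseteq> R1" "chain_system d e A R' v' c'"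
      "\<forall>P\<in>A. v' P ! 0 dvd d" "\<forall>Q\<in>R'. ?out Q dvd d" "(\<Union>P\<in>A. c' P) \<union> R' = (\<Union>P\<in>A. c1 P) \<union> R1"
      using less(1)[of R1 v1 c1] by blast
    moreover have "(\<Union>P\<in>A. c1 P) \<union> R1 = (\<Union>P\<in>A. c P) \<union> R"
      using Q(1) P(1) by (auto simp: c1_def R1_def split: if_splits)
    ultimately show ?thesis by (intro exI[of _ v'] exI[of _ c'] exI[of _ R']) (auto simp: R1_def)
  qed
qed

section \<open>The equation phi(F) = sigma(G)\<close>

lemma coprime_of_no_common_prime_poly:
  fixes A B :: "'a::{field,finite} poly"
  assumes "A \<noteq> 0" "\<And>P. prime_poly P \<Longrightarrow> P dvd A \<Longrightarrow> P dvd B \<Longrightarrow> False"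
  shows "coprime A B"
proof (rule coprimeI)
  fix C assume C: "C dvd A" "C dvd B"
  show "is_unit C"
  proof (rule ccontr)
    assume "\<not> is_unit C"
    moreover have "C \<noteq> 0" using C assms(1) by auto
    ultimately have "degree C > 0" using is_unit_iff_degree[of C] by simp
    then obtain P where "prime_poly P" "P dvd C" using exists_prime_poly_dvd[OF \<open>C \<noteq> 0\<close>] by blast
    then show False using assms(2)[of P] C dvd_trans by blast
  qed
qed

lemma abs_poly_gt_1:
  fixes P :: "'a::{field,finite} poly"
  assumes "prime_poly P" "CARD('a) \<ge> 2"
  shows "abs_poly P > 1"
  unfolding abs_poly_def using assms prime_poly_degree_pos[OF assms(1)] by (intro one_less_power) auto

text \<open>Every term except the one for \<open>i = 0\<close> is divisible by the size of the
  field.\<close>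

lemma sum_power_abs_poly_cong_1:
  fixes P :: "'a::{field,finite} poly"
  assumes "prime_poly P"
  shows "[(\<Sum>i\<le>k. abs_poly P ^ i) = 1] (mod CARD('a))"
proof -
  have "CARD('a) dvd abs_poly P"
    unfolding abs_poly_def using prime_poly_degree_pos[OF assms] by (simp add: dvd_power)
  then have "CARD('a) dvd abs_poly P ^ Suc i" for i by (simp add: dvd_mult2)
  then have "CARD('a) dvd (\<Sum>i<k. abs_poly P ^ Suc i)" by (intro dvd_sum) blast
  moreover have "(\<Sum>i\<le>k. abs_poly P ^ i) = 1 + (\<Sum>i<k. abs_poly P ^ Suc i)"
    by (simp only: sum.atMost_shift power_0)
  ultimately obtain m where "(\<Sum>i\<le>k. abs_poly P ^ i) = 1 + CARD('a) * m" by (metis dvdE)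
  then show ?thesis by (simp only: cong_def mod_mult_self2)
qed

lemma count_image_mset_set:
  assumes "finite S"
  shows "count (image_mset f (mset_set S)) n = (\<Sum>x\<in>S. of_bool (f x = n))"
  using assms by (induction S rule: finite_induct) auto

text \<open>A repeated prime in the first product would make phi divisible by \<open>q\<close>,
  while sigma is 1 modulo \<open>q\<close>. Multiplying the equation by the product of
  \<open>abs_poly Q - 1\<close> over \<open>T\<close> closes the geometric sums and leaves an
  identity between products of numbers \<open>q ^ a - 1\<close>.\<close>

lemma phi_eq_sigma_degrees:
  fixes S T :: "'a::{field,finite} poly set"
  assumes q: "q = CARD('a)" "q \<in> {2, 3}"
    and S: "finite S" "\<And>P. P \<in> S \<Longrightarrow> prime_poly P \<and> f P > 0"
    and T: "finite T" "\<And>P. P \<in> T \<Longrightarrow> prime_poly P \<and> e P > 0"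
    and eq: "phi_poly (\<Prod>P\<in>S. P ^ f P) = sigma_poly (\<Prod>P\<in>T. P ^ e P)"
  shows "\<forall>P\<in>S. f P = 1"
    and "\<And>n. \<not> n dvd d_const q \<Longrightarrow>
      (\<Sum>P\<in>S. of_bool (degree P = n)) + (\<Sum>Q\<in>T. of_bool (degree Q = n))
        = (\<Sum>Q\<in>T. of_bool (degree Q * (e Q + 1) = n) :: nat)"
proof -
  have q2: "CARD('a) \<ge> 2" using q by auto
  have phi: "phi_poly (\<Prod>P\<in>S. P ^ f P) = (\<Prod>P\<in>S. abs_poly P ^ (f P - 1) * (abs_poly P - 1))"
    using S by (intro phi_poly_prod) auto
  have sigma: "sigma_poly (\<Prod>P\<in>T. P ^ e P) = (\<Prod>P\<in>T. \<Sum>i\<le>e P. abs_poly P ^ i)"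
    using T by (intro sigma_poly_prod) auto
  have "[(\<Prod>P\<in>T. \<Sum>i\<le>e P. abs_poly P ^ i) = (\<Prod>P\<in>T. 1)] (mod CARD('a))"
    using T by (intro cong_prod sum_power_abs_poly_cong_1) auto
  then have nd: "\<not> CARD('a) dvd (\<Prod>P\<in>T. \<Sum>i\<le>e P. abs_poly P ^ i)"
    using q2 cong_dvd_iff[of _ 1 "CARD('a)"] by auto
  show f1: "\<forall>P\<in>S. f P = 1"
  proof (rule ballI, rule ccontr)
    fix P assume P: "P \<in> S" and "f P \<noteq> 1"
    then have "f P - 1 > 0" using S(2)[OF P] by linarith
    then have "CARD('a) dvd abs_poly P ^ (f P - 1) * (abs_poly P - 1)"
      unfolding abs_poly_def using prime_poly_degree_pos[of P] S(2)[OF P]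
      by (intro dvd_mult2) (simp add: dvd_power flip: power_mult)
    also have "\<dots> dvd (\<Prod>P\<in>S. abs_poly P ^ (f P - 1) * (abs_poly P - 1))"
      using S(1) P by (rule dvd_prodI)
    finally show False using nd phi sigma eq by simp
  qed
  define A where "A = image_mset degree (mset_set S) + image_mset degree (mset_set T)"
  define B where "B = image_mset (\<lambda>Q. degree Q * (e Q + 1)) (mset_set T)"
  have pos: "a > 0" if "a \<in># A + B" for a
    using that S T prime_poly_degree_pos by (auto simp: A_def B_def)
  have "(\<Prod>a\<in>#A. q ^ a - 1) = (\<Prod>P\<in>S. abs_poly P - 1) * (\<Prod>P\<in>T. abs_poly P - 1)"
    by (simp add: A_def abs_poly_def q(1) prod_unfold_prod_mset image_mset.compositionality comp_def)
  also have "(\<Prod>P\<in>S. abs_poly P - 1) = (\<Prod>P\<in>T. \<Sum>i\<le>e P. abs_poly P ^ i)"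
    using eq f1 unfolding phi sigma by simp
  also have "\<dots> * (\<Prod>P\<in>T. abs_poly P - 1) = (\<Prod>P\<in>T. abs_poly P ^ (e P + 1) - 1)"
    unfolding prod.distrib[symmetric]
  proof (rule prod.cong)
    fix P assume "P \<in> T"
    then have "abs_poly P \<ge> 1" using T abs_poly_gt_1[OF _ q2] by force
    then show "(\<Sum>i\<le>e P. abs_poly P ^ i) * (abs_poly P - 1) = abs_poly P ^ (e P + 1) - 1"
      using power_minus_one_factor_nat[of "abs_poly P" "e P + 1"] by (simp add: lessThan_Suc_atMost mult.commute)
  qed simp
  also have "\<dots> = (\<Prod>b\<in>#B. q ^ b - 1)"
    by (simp add: B_def abs_poly_def q(1) prod_unfold_prod_mset image_mset.compositionality comp_def
        power_add power_mult)
  finally have prods: "(\<Prod>a\<in>#A. q ^ a - 1) = (\<Prod>b\<in>#B. q ^ b - 1)" .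
  fix n assume "\<not> n dvd d_const q"
  then have "count A n = count B n"
    using count_eq_of_prod_power_minus_one_eq[OF q(2) pos prods] by blast
  then show "(\<Sum>P\<in>S. of_bool (degree P = n)) + (\<Sum>Q\<in>T. of_bool (degree Q = n))
        = (\<Sum>Q\<in>T. of_bool (degree Q * (e Q + 1) = n) :: nat)"
    unfolding A_def B_def using S(1) T(1) by (simp only: count_union count_image_mset_set)
qed

theorem theorem1p3:
  fixes q :: nat
  assumes "q = CARD('a::{field,finite})" and "q \<in> {2, 3}"
  shows "\<exists>E :: ('a poly \<times> 'a poly) set. finite E \<and>
    (\<forall>F G :: 'a poly. F \<noteq> 0 \<and> G \<noteq> 0 \<and> monic_poly F \<and> monic_poly G \<and> phi_poly F = sigma_poly G \<longrightarrow>
      (\<exists>(n::nat) (Fs :: nat \<Rightarrow> 'a poly) (Gs :: nat \<Rightarrow> 'a poly).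
        F = (\<Prod>i=0..n. Fs i) \<and> G = (\<Prod>i=0..n. Gs i) \<and>
        (\<forall>i\<in>{0..n}. monic_poly (Fs i) \<and> monic_poly (Gs i)) \<and>
        (\<forall>i\<in>{0..n}. \<forall>j\<in>{0..n}. i \<noteq> j \<longrightarrow> coprime (Fs i) (Fs j) \<and> coprime (Gs i) (Gs j)) \<and>
        (Fs 0, Gs 0) \<in> E \<and>
        (\<forall>i\<in>{1..n}. \<exists>v :: nat list. v \<noteq> [] \<and> (\<forall>x\<in>set v. x > 0) \<and> v ! 0 dvd d_const q \<and>
           (Fs i, Gs i) \<in> V_set v)))"
proof -
  define d where "d = d_const q"
  have d0: "d > 0" by (simp add: d_def d_const_def)
  \<comment> \<open>Bounds the degree of the leftover part of \<open>G\<close>: its primes have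
    degree at most \<open>d\<close>, and so does each of its prime powers.\<close>
  define N where "N = d * card {Q :: 'a poly. degree Q \<le> d}"
  define E where "E = {1 :: 'a poly} \<times> {G :: 'a poly. degree G \<le> N}"
  have "finite E" unfolding E_def by (intro finite_cartesian_product finite_degree_le) simp
  moreover have "\<exists>(n::nat) (Fs :: nat \<Rightarrow> 'a poly) (Gs :: nat \<Rightarrow> 'a poly).
        F = (\<Prod>i=0..n. Fs i) \<and> G = (\<Prod>i=0..n. Gs i) \<and>
        (\<forall>i\<in>{0..n}. monic_poly (Fs i) \<and> monic_poly (Gs i)) \<and>
        (\<forall>i\<in>{0..n}. \<forall>j\<in>{0..n}. i \<noteq> j \<longrightarrow> coprime (Fs i) (Fs j) \<and> coprime (Gs i) (Gs j)) \<and>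
        (Fs 0, Gs 0) \<in> E \<and>
        (\<forall>i\<in>{1..n}. \<exists>v :: nat list. v \<noteq> [] \<and> (\<forall>x\<in>set v. x > 0) \<and> v ! 0 dvd d_const q \<and>
           (Fs i, Gs i) \<in> V_set v)"
    if FG: "monic_poly F" "monic_poly G" "phi_poly F = sigma_poly G" for F G :: "'a poly"
  proof -
    obtain S f where S: "finite S" "\<forall>P\<in>S. prime_poly P \<and> f P > (0::nat)" and F: "F = (\<Prod>P\<in>S. P ^ f P)"
      using exists_prime_poly_factorization[OF FG(1)] by blast
    obtain T e where T: "finite T" "\<forall>P\<in>T. prime_poly P \<and> e P > (0::nat)" and G: "G = (\<Prod>P\<in>T. P ^ e P)"
      using exists_prime_poly_factorization[OF FG(2)] by blast
    have eq: "phi_poly (\<Prod>P\<in>S. P ^ f P) = sigma_poly (\<Prod>P\<in>T. P ^ e P)"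
      using FG(3) F G by simp
    have Sp: "\<And>P. P \<in> S \<Longrightarrow> prime_poly P \<and> f P > 0" and Tp: "\<And>P. P \<in> T \<Longrightarrow> prime_poly P \<and> e P > 0"
      using S T by auto
    note deg = phi_eq_sigma_degrees[OF assms S(1) Sp T(1) Tp eq]
    have F': "F = \<Prod>S" using deg(1) F by simp
    have "chain_system d e S T (\<lambda>P. [degree P]) (\<lambda>_. {})"
      unfolding chain_system_def using deg(2) Sp V_set_singleton prime_poly_degree_pos by (auto simp: d_def)
    then have "\<exists>v c R. R \<subseteq> T \<and> chain_system d e S R v c \<and>
        (\<forall>P\<in>S. v P ! 0 dvd d) \<and> (\<forall>Q\<in>R. degree Q * (e Q + 1) dvd d) \<and>
        (\<Union>P\<in>S. c P) \<union> R = (\<Union>P\<in>S. {}) \<union> T"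
      by (intro chain_system_complete[OF S(1) T(1) Tp])
    then obtain v c R where R: "R \<subseteq> T" and cs: "chain_system d e S R v c"
      and v: "\<forall>P\<in>S. v P ! 0 dvd d" and out: "\<forall>Q\<in>R. degree Q * (e Q + 1) dvd d"
      and un: "(\<Union>P\<in>S. c P) \<union> R = (\<Union>P\<in>S. {}) \<union> T"
      by (elim exE conjE) (rule that)
    note cs = cs[unfolded chain_system_def]
    have finR: "finite R" using R T(1) finite_subset by blast
    have cT: "c P \<subseteq> T" if "P \<in> S" for P using un that by blast
    obtain h where h: "bij_betw h {1..card S} S"
      using ex_bij_betw_nat_finite_1[OF S(1)] by blast
    define n where "n = card S"
    \<comment> \<open>Index 0 carries the leftover primes \<open>R\<close>, paired with
      \<open>1\<close> on the side of \<open>F\<close>; the indices from 1 to \<open>n\<close>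
      enumerate the primes of \<open>F\<close> with their chains.\<close>
    define U where "U = (\<lambda>i. if i = 0 then R else c (h i))"
    define Fs where "Fs = (\<lambda>i. if i = 0 then 1 else h i)"
    define Gs where "Gs = (\<lambda>i. \<Prod>Q\<in>U i. Q ^ e Q)"
    have himg: "h ` {1..n} = S" using h by (simp add: n_def bij_betw_def)
    have hS: "h i \<in> S" if "i \<in> {1..n}" for i using h that unfolding n_def bij_betw_def by blast
    have hinj: "h i \<noteq> h j" if "i \<in> {1..n}" "j \<in> {1..n}" "i \<noteq> j" for i j
      using h that unfolding n_def bij_betw_def inj_on_def by blast
    have UT: "U i \<subseteq> T" "finite (U i)" if "i \<in> {0..n}" for i
    proof -
      show "U i \<subseteq> T" using that R cT hS by (cases "i = 0") (auto simp: U_def)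
      then show "finite (U i)" using T(1) finite_subset by blast
    qed
    have Udisj: "U i \<inter> U j = {}" if ij: "i \<in> {0..n}" "j \<in> {0..n}" "i \<noteq> j" for i j
    proof -
      have "c P \<inter> R = {}" if "P \<in> S" for P using cs that by blast
      moreover have "c P \<inter> c P' = {}" if "P \<in> S" "P' \<in> S" "P \<noteq> P'" for P P' using cs that by blast
      ultimately show ?thesis
        using ij hS[of i] hS[of j] hinj[of i j] by (cases "i = 0"; cases "j = 0") (auto simp: U_def)
    qed
    have split: "{0..n} = insert 0 {1..n}" by auto
    have Uun: "(\<Union>i\<in>{0..n}. U i) = T"
    proof -
      have "(\<Union>i\<in>{1..n}. U i) = (\<Union>i\<in>{1..n}. c (h i))" by (auto simp: U_def)
      also have "\<dots> = (\<Union>P\<in>S. c P)" unfolding himg[symmetric] by simp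
      finally have "(\<Union>i\<in>{1..n}. U i) = (\<Union>P\<in>S. c P)" .
      moreover have "U 0 = R" by (simp add: U_def)
      ultimately show ?thesis unfolding split using un by blast
    qed
    show ?thesis
    proof (rule exI[of _ n], rule exI[of _ Fs], rule exI[of _ Gs], intro conjI ballI impI)
      have "(\<Prod>i=0..n. Fs i) = (\<Prod>i\<in>{1..n}. h i)"
        unfolding split by (simp add: Fs_def)
      also have "\<dots> = \<Prod>S"
        using prod.reindex_bij_betw[OF h, of "\<lambda>x. x"] by (simp add: n_def)
      finally show "F = (\<Prod>i=0..n. Fs i)" using F' by simp
      have "(\<Prod>i=0..n. Gs i) = (\<Prod>Q\<in>(\<Union>i\<in>{0..n}. U i). Q ^ e Q)"
        unfolding Gs_def using UT Udisj by (intro prod.UNION_disjoint[symmetric]) auto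
      then show "G = (\<Prod>i=0..n. Gs i)" using G Uun by simp
    next
      fix i assume i: "i \<in> {0..n}"
      show "monic_poly (Fs i)" 
        using hS[of i] Sp[of "h i"] prime_poly_monic[of "h i"] i by (auto simp: Fs_def)
      show "monic_poly (Gs i)" unfolding Gs_def using UT[OF i] Tp by (intro monic_prod_prime_power) blast
    next
      fix i j assume ij: "i \<in> {0..n}" "j \<in> {0..n}" "i \<noteq> j"
      show "coprime (Fs i) (Fs j)"
      proof (cases "i = 0 \<or> j = 0")
        case False
        then have "h i \<in> S" "h j \<in> S" "h i \<noteq> h j" using ij hS hinj by auto
        moreover from this have "prime_poly (h i)" "prime_poly (h j)" using Sp by blast+
        ultimately have "coprime (h i) (h j)"
          by (intro coprime_of_no_common_prime_poly) (simp_all add: prime_poly_nonzero, metis prime_poly_dvd_imp_eq)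
        then show ?thesis using False by (simp add: Fs_def)
      qed (auto simp: Fs_def)
      show "coprime (Gs i) (Gs j)"
      proof (rule coprime_of_no_common_prime_poly)
        have "lead_coeff (Gs i) = 1" unfolding Gs_def using UT[OF ij(1)] Tp by (intro monic_prod_prime_power) blast
        then show "Gs i \<noteq> 0" by auto
        fix P :: "'a poly" assume P: "prime_poly P" "P dvd Gs i" "P dvd Gs j"
        have "P dvd Gs k \<longleftrightarrow> P \<in> U k" if "k \<in> {0..n}" for k
          unfolding Gs_def by (rule prime_poly_dvd_prod_iff) (use UT[OF that] Tp P in auto)
        then show False using P ij Udisj by blast
      qed
    next
      have "degree (\<Prod>Q\<in>R. Q ^ e Q) \<le> (\<Sum>Q\<in>R. degree (Q ^ e Q))"
        using degree_prod_sum_le[OF finR, of "\<lambda>Q. Q ^ e Q"] by (simp add: comp_def)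
      also have "\<dots> \<le> (\<Sum>Q\<in>R. d)"
      proof (rule sum_mono)
        fix Q assume Q: "Q \<in> R"
        have "degree (Q ^ e Q) \<le> degree Q * (e Q + 1)" using degree_power_le[of Q "e Q"] by simp
        also have "\<dots> \<le> d" using out Q d0 dvd_imp_le by blast
        finally show "degree (Q ^ e Q) \<le> d" .
      qed
      also have "\<dots> = d * card R" by simp
      also have "\<dots> \<le> N"
      proof -
        have "R \<subseteq> {Q. degree Q \<le> d}"
        proof
          fix Q assume "Q \<in> R"
          then have "degree Q * (e Q + 1) \<le> d" using out d0 dvd_imp_le by blast
          then show "Q \<in> {Q. degree Q \<le> d}" by simp
        qed
        then show ?thesis unfolding N_def by (intro mult_left_mono card_mono finite_degree_le) auto
      qed
      finally show "(Fs 0, Gs 0) \<in> E" by (simp add: E_def Fs_def Gs_def U_def)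
    next
      fix i assume i: "i \<in> {1..n}"
      have "(Fs i, Gs i) = (h i, \<Prod>Q\<in>c (h i). Q ^ e Q)" using i by (simp add: Fs_def Gs_def U_def)
      then show "\<exists>v :: nat list. v \<noteq> [] \<and> (\<forall>x\<in>set v. x > 0) \<and> v ! 0 dvd d_const q \<and> (Fs i, Gs i) \<in> V_set v"
        using cs v hS[OF i] unfolding d_def by (intro exI[of _ "v (h i)"]) auto
    qed
  qed
  ultimately show ?thesis by blast
qed

end
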